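(* A planar curve $\gamma:I\to\mathbb{C}$ possesses the Miura self-affinity (MSA) if and only if it is either a circle, a line, or a log-aesthetic curve (LAC).
   Context: Identify $\mathbb{C}$ with $\mathbb{R}^2$. A curve is a smooth map $\gamma:I\to\mathbb{C}$ on an interval $I\subset\mathbb{R}$ with nowhere vanishing derivative, together with a fixed base point $\eta_\gamma\in I$. A reparametrization between curves $\gamma_1:I_1\to\mathbb{C}$ and $\gamma_2:I_2\to\mathbb{C}$ is a smooth homeomorphism $t:I_1\to I_2$ with $t(\eta_{\gamma_1})=\eta_{\gamma_2}$ and $\gamma_1=\gamma_2\circ t$. Every curve $\gamma$ has a unique increasing arc length parameter $s=s_\gamma$ with $s=0$ at the base point and $|d\gamma/ds|=1$. The curvature is $\kappa_\gamma(s)=\frac{d}{ds}\arg\left(\frac{d\gamma}{ds}\right)$, so that $\frac{d^2\gamma}{ds^2}=\sqrt{-1}\,\kappa_\gamma\frac{d\gamma}{ds}$, and the curvature radius is $\rho_\gamma=1/\kappa_\gamma$. Shift: for a curve $\gamma(t)$ defined on an interval $J$ with base point $\eta\in J$ and for $\varepsilon>0$, the $\varepsilon$-shift $\Lambda_\varepsilon\gamma$ is the curve $\Lambda_\varepsilon\gamma(t)=\gamma(t+\varepsilon)$ on $J-\varepsilon$. For a function $F_\gamma$ attached to curves one writes $\Lambda_\varepsilon F_\gamma:=F_{\Lambda_\varepsilon\gamma}$. For the arc length $s(t)$ and the curvature radius $\rho(t)$, as functions of the parameter $t$, this means $$\Lambda_\varepsilon s(t)=s(t+\varepsilon)-s(\eta+\varepsilon),\qquad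 \Lambda_\varepsilon\rho(t)=\rho(t+\varepsilon).$$ MSA: a curve $\gamma(s):I\to\mathbb{C}$ (with arc length parameter $s$) possesses the Miura self-affinity if there exist $\mu,\nu>0$ and a reparametrization $t(s):I\to J$ such that for any $\varepsilon>0$, $$\Lambda_\varepsilon\bigl(s_\gamma(t),\rho_\gamma(t)\bigr)=\bigl(\mu^\varepsilon s_\gamma(t),\ \nu^\varepsilon\rho_\gamma(t)\bigr)\quad\text{for all }t\in J.$$ LAC: a log-aesthetic curve of slope $\alpha$ is a curve defined by $$\rho(s)=(\xi s+\eta)^{1/\alpha}\ (\alpha\neq0),\qquad \rho(s)=e^{\xi s+\eta}\ (\alpha=0),$$ restricted to $\{s\mid \xi s+\eta\ge 0\}$, where $\xi\in\mathbb{R}\setminus\{0\}$ and $\alpha,\eta\in\mathbb{R}$ are constants (this $\eta$ is unrelated to base points). This equation determines the curve uniquely up to the congruence group $\{z\mapsto Az+b\mid A\in O(2),\ b\in\mathbb{C}\}$.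
   Formalization: LAC means sub-arcs with ξs+η>0 (not ≥0) for α≠0 and no domain restriction for α=0; the MSA relation is required only for t in J∩(J−ε) and shifts keeping the base point in the domain, with at least one such shift; circles and lines include arcs and segments. *)

theory Defs
  imports "HOL-Analysis.Analysis"
begin

text \<open>Smoothness on an arbitrary interval; at an endpoint belonging to the interval the
  derivatives are one-sided.\<close>

definition smooth_on :: "real set \<Rightarrow> (real \<Rightarrow> 'a::real_normed_vector) \<Rightarrow> bool" where
  "smooth_on I f \<longleftrightarrow>
     (\<exists>D :: nat \<Rightarrow> real \<Rightarrow> 'a. D 0 = f \<and>
        (\<forall>n. \<forall>t\<in>I. (D n has_vector_derivative D (Suc n) t) (at t within I)))"

text \<open>A parametrized planar curve: its interval, the map (only its values on the interval
  matter) and the base point.\<close>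

record pcurve =
  cdomain :: "real set"
  cmap :: "real \<Rightarrow> complex"
  cbase :: real

definition velocity :: "pcurve \<Rightarrow> real \<Rightarrow> complex" where
  "velocity \<gamma> t = vector_derivative (cmap \<gamma>) (at t within cdomain \<gamma>)"

definition is_curve :: "pcurve \<Rightarrow> bool" where
  "is_curve \<gamma> \<longleftrightarrow>
     is_interval (cdomain \<gamma>) \<and> (\<exists>x\<in>cdomain \<gamma>. \<exists>y\<in>cdomain \<gamma>. x < y) \<and>
     cbase \<gamma> \<in> cdomain \<gamma> \<and>
     smooth_on (cdomain \<gamma>) (cmap \<gamma>) \<and>
     (\<forall>t\<in>cdomain \<gamma>. velocity \<gamma> t \<noteq> 0)"

definition reparametrization :: "pcurve \<Rightarrow> pcurve \<Rightarrow> (real \<Rightarrow> real) \<Rightarrow> bool" where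
  "reparametrization \<gamma>\<^sub>1 \<gamma>\<^sub>2 t \<longleftrightarrow>
     smooth_on (cdomain \<gamma>\<^sub>1) t \<and>
     (\<exists>t'. homeomorphism (cdomain \<gamma>\<^sub>1) (cdomain \<gamma>\<^sub>2) t t') \<and>
     t (cbase \<gamma>\<^sub>1) = cbase \<gamma>\<^sub>2 \<and>
     (\<forall>u\<in>cdomain \<gamma>\<^sub>1. cmap \<gamma>\<^sub>1 u = cmap \<gamma>\<^sub>2 (t u))"

text \<open>The arc length is signed: for \<open>t\<close> to the left of the base point the interval integral
  is the negative of the integral from \<open>t\<close> to the base point.\<close>

definition arclength :: "pcurve \<Rightarrow> real \<Rightarrow> real" where
  "arclength \<gamma> t = (LBINT u=cbase \<gamma>..t. norm (velocity \<gamma> u))"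

text \<open>The derivative of \<open>arg (d\<gamma>/ds)\<close> with respect to arc length. Near \<open>t\<close> the branch of the
  argument is chosen by dividing by the direction at \<open>t\<close>, which keeps \<open>Arg\<close> away from its cut;
  the positive factor between \<open>d\<gamma>/dt\<close> and \<open>d\<gamma>/ds\<close> does not affect \<open>Arg\<close>, and \<open>ds/dt\<close> is the
  speed.\<close>

definition curvature :: "pcurve \<Rightarrow> real \<Rightarrow> real" where
  "curvature \<gamma> t =
     vector_derivative (\<lambda>u. Arg (velocity \<gamma> u / velocity \<gamma> t)) (at t within cdomain \<gamma>)
       / norm (velocity \<gamma> t)"

text \<open>Extended-real division: the radius is \<open>\<infinity>\<close> where the curvature vanishes, so that it is
  also defined for lines and at inflection points.\<close>

definition curvature_radius :: "pcurve \<Rightarrow> real \<Rightarrow> ereal" where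
  "curvature_radius \<gamma> t = 1 / ereal (curvature \<gamma> t)"

definition shift :: "real \<Rightarrow> pcurve \<Rightarrow> pcurve" where
  "shift \<epsilon> \<gamma> = \<gamma>\<lparr>cdomain := (\<lambda>t. t - \<epsilon>) ` cdomain \<gamma>, cmap := (\<lambda>t. cmap \<gamma> (t + \<epsilon>))\<rparr>"

text \<open>The \<open>\<epsilon>\<close>-shift of a curve on \<open>J\<close> lives on \<open>J - \<epsilon>\<close> with the same base point. It is
  therefore a curve only if the base point lies in \<open>J - \<epsilon>\<close>, and the two sides of the affinity
  relation can be compared exactly on \<open>J \<inter> (J - \<epsilon>)\<close>. The clause requiring that some shift is a
  curve says that the base point is not the last point of \<open>J\<close>; it is automatic for open \<open>J\<close> and
  excludes the case in which the relation would be vacuous.\<close>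

definition MSA :: "pcurve \<Rightarrow> bool" where
  "MSA \<gamma> \<longleftrightarrow>
     (\<exists>\<mu>>0. \<exists>\<nu>>0. \<exists>\<gamma>' t.
        is_curve \<gamma>' \<and> reparametrization \<gamma> \<gamma>' t \<and>
        (\<exists>\<epsilon>>0. is_curve (shift \<epsilon> \<gamma>')) \<and>
        (\<forall>\<epsilon>>0. is_curve (shift \<epsilon> \<gamma>') \<longrightarrow>
           (\<forall>t \<in> cdomain \<gamma>' \<inter> cdomain (shift \<epsilon> \<gamma>').
              arclength (shift \<epsilon> \<gamma>') t = \<mu> powr \<epsilon> * arclength \<gamma>' t \<and>
              curvature_radius (shift \<epsilon> \<gamma>') t = ereal (\<nu> powr \<epsilon>) * curvature_radius \<gamma>' t)))"

text \<open>The restriction to \<open>\<xi> s + \<eta> \<ge> 0\<close> makes the power meaningful and hence concerns only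
  \<open>\<alpha> \<noteq> 0\<close>. It appears here as a strict inequality: where \<open>\<xi> s + \<eta> = 0\<close> the prescribed radius is
  \<open>0\<close> for \<open>\<alpha> > 0\<close>, impossible for a smooth curve, and the power is undefined for \<open>\<alpha> < 0\<close>.\<close>

definition lac_equation :: "real \<Rightarrow> real \<Rightarrow> real \<Rightarrow> pcurve \<Rightarrow> bool" where
  "lac_equation \<alpha> \<xi> \<eta> \<gamma> \<longleftrightarrow>
     (\<forall>t\<in>cdomain \<gamma>.
        let s = arclength \<gamma> t in
          if \<alpha> = 0 then curvature_radius \<gamma> t = ereal (exp (\<xi> * s + \<eta>))
          else \<xi> * s + \<eta> > 0 \<and>
               curvature_radius \<gamma> t = ereal ((\<xi> * s + \<eta>) powr (1 / \<alpha>)))"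

text \<open>Curves are classified up to the congruence group, whose reflections change the sign of the
  curvature radius.\<close>

definition is_LAC :: "pcurve \<Rightarrow> bool" where
  "is_LAC \<gamma> \<longleftrightarrow>
     (\<exists>A b. orthogonal_transformation A \<and>
        (\<exists>\<alpha> \<xi> \<eta>. \<xi> \<noteq> 0 \<and> lac_equation \<alpha> \<xi> \<eta> (\<gamma>\<lparr>cmap := (\<lambda>t. A (cmap \<gamma> t) + b)\<rparr>)))"

text \<open>The domain of a curve is an arbitrary interval, so ``circle'' and ``line'' allow arcs and
  segments.\<close>

definition is_circle :: "pcurve \<Rightarrow> bool" where
  "is_circle \<gamma> \<longleftrightarrow> (\<exists>c r. r > 0 \<and> cmap \<gamma> ` cdomain \<gamma> \<subseteq> sphere c r)"

definition is_line :: "pcurve \<Rightarrow> bool" where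
  "is_line \<gamma> \<longleftrightarrow> (\<exists>L. affine L \<and> aff_dim L = 1 \<and> cmap \<gamma> ` cdomain \<gamma> \<subseteq> L)"

end

theory Submission
  imports Defs
begin

text \<open>Let \<open>s\<close> and \<open>\<kappa>\<close> be the arc length and the curvature of the reparametrized curve. Differentiating
  the affinity relation of the arc length at \<open>\<epsilon> = 0\<close> gives \<open>s' = s'(base) + ln \<mu> * s\<close>, so that \<open>s\<close> is
  linear or a shifted exponential in the parameter, while the relation of the radii makes
  \<open>\<kappa> * \<nu> powr t\<close> locally constant. Eliminating \<open>t\<close> expresses \<open>\<kappa>\<close> as an exponential of \<open>s\<close> or as a power
  of an affine function of \<open>s\<close>; lines and circles are the degenerate cases. Conversely, the elimination
  is reversible and prescribes the parameter \<open>t\<close> as a function of \<open>s\<close>.\<close>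

subsection \<open>Smooth functions on an interval\<close>

text \<open>Shifts are one-sided and limited: only \<epsilon> > 0 that keep the base point inside
  are allowed, so a bounded interval has only bounded shifts and its last point satisfies no
  relation. Hence the arc length is handled by a right derivative at \<epsilon> = 0, and the
  curvature by local constancy and connectedness. The radius may be infinite. Its relation is
  therefore rewritten as \<open>\<kappa> (t + \<epsilon>) * \<nu> powr \<epsilon> = \<kappa>
  t\<close>, which covers lines and inflection points without a case split. A reparametrization may
  reverse the orientation, so a common sign accompanies s and \<kappa>. It is absorbed by the
  reflections and by the free sign of \<xi> in the definition of a LAC. The elimination rests on
  \<open>1 + \<beta> * s = \<mu> powr (t - base)\<close>, where \<beta> is ln \<mu> divided by the
  signed speed at the base point. It leads to one normal form of the curvature with parameters
  \<beta>, d, k, and neither direction has to distinguish lines, circles and the two kinds of LAC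
  while dealing with shifts.\<close>

lemma smooth_on_coinduct [consumes 1, case_names derivative]:
  assumes "P f"
    and step: "\<And>g. P g \<Longrightarrow> \<exists>g'. P g' \<and> (\<forall>t\<in>I. (g has_vector_derivative g' t) (at t within I))"
  shows "smooth_on I f"
proof -
  \<comment> \<open>With one derivative operator \<open>d\<close> fixed on the class
    \<open>P\<close>, its iterates are the sequence that smoothness asks for. Closure properties
    thus need only an invariant class of functions, no formula for higher derivatives.\<close>
  obtain d where d: "\<And>g. P g \<Longrightarrow> P (d g) \<and> (\<forall>t\<in>I. (g has_vector_derivative d g t) (at t within I))"
    using step by metis
  have "P ((d ^^ n) f)" for n
    by (induction n) (use assms(1) d in auto)
  then show ?thesis
    unfolding smooth_on_def using d by (intro exI[of _ "\<lambda>n. (d ^^ n) f"]) simp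
qed

lemma smooth_on_derivE:
  assumes "smooth_on I f"
  obtains f' where "smooth_on I f'" "\<And>t. t \<in> I \<Longrightarrow> (f has_vector_derivative f' t) (at t within I)"
proof -
  obtain D where D: "D 0 = f" "\<And>n t. t \<in> I \<Longrightarrow> (D n has_vector_derivative D (Suc n) t) (at t within I)"
    using assms unfolding smooth_on_def by blast
  have "smooth_on I (D 1)"
    unfolding smooth_on_def using D(2) by (intro exI[of _ "\<lambda>n. D (Suc n)"]) simp
  then show thesis using that D by (metis One_nat_def)
qed

lemma smooth_on_antideriv:
  assumes "smooth_on I f'" "\<And>t. t \<in> I \<Longrightarrow> (f has_vector_derivative f' t) (at t within I)"
  shows "smooth_on I f"
proof -
  \<comment> \<open>The invariant class consists of \<open>f\<close> itself and all smooth
    functions.\<close>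
  have "f = f \<or> smooth_on I f" by simp
  then show ?thesis
    by (rule smooth_on_coinduct) (metis assms smooth_on_derivE)
qed

text \<open>The sequence in the definition starts with \<open>f\<close> itself and so pins its
  values off \<open>I\<close> as well. Derivatives within \<open>I\<close> do not see those values,
  so \<open>g\<close> is an antiderivative of the same smooth function.\<close>

lemma smooth_on_cong:
  assumes "\<And>t. t \<in> I \<Longrightarrow> f t = g t" "smooth_on I f"
  shows "smooth_on I g"
proof -
  obtain f' where "smooth_on I f'" "\<And>t. t \<in> I \<Longrightarrow> (f has_vector_derivative f' t) (at t within I)"
    using assms(2) smooth_on_derivE by blast
  moreover from this have "(g has_vector_derivative f' t) (at t within I)" if "t \<in> I" for t
    using that has_vector_derivative_transform[of t I g f "f' t"] assms(1) by simp
  ultimately show ?thesis using smooth_on_antideriv by blast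
qed

lemma smooth_on_continuous_on:
  assumes "smooth_on I f"
  shows "continuous_on I f"
  using smooth_on_derivE[OF assms] by (metis continuous_on_vector_derivative)

lemma smooth_on_const: "smooth_on I (\<lambda>t. c)"
  by (rule smooth_on_coinduct[where P = "\<lambda>f. \<exists>c. f = (\<lambda>t. c)"])
    (auto intro!: exI[of _ "\<lambda>_. 0"])

lemma smooth_on_linear:
  assumes "bounded_linear h" "smooth_on I f"
  shows "smooth_on I (\<lambda>t. h (f t))"
proof (rule smooth_on_coinduct[where P = "\<lambda>g. \<exists>f. smooth_on I f \<and> g = (\<lambda>t. h (f t))"])
  fix g assume "\<exists>f. smooth_on I f \<and> g = (\<lambda>t. h (f t))"
  then obtain f where f: "smooth_on I f" "g = (\<lambda>t. h (f t))" by blast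
  obtain f' where "smooth_on I f'" "\<And>t. t \<in> I \<Longrightarrow> (f has_vector_derivative f' t) (at t within I)"
    using smooth_on_derivE[OF f(1)] by blast
  then show "\<exists>g'. (\<exists>f. smooth_on I f \<and> g' = (\<lambda>t. h (f t))) \<and>
      (\<forall>t\<in>I. (g has_vector_derivative g' t) (at t within I))"
    unfolding f(2) using bounded_linear.has_vector_derivative[OF assms(1)] by blast
qed (use assms in blast)

lemma smooth_on_add:
  assumes "smooth_on I f" "smooth_on I g"
  shows "smooth_on I (\<lambda>t. f t + g t)"
proof (rule smooth_on_coinduct[where P = "\<lambda>h. \<exists>f g. smooth_on I f \<and> smooth_on I g \<and> h = (\<lambda>t. f t + g t)"])
  fix h assume "\<exists>f g. smooth_on I f \<and> smooth_on I g \<and> h = (\<lambda>t. f t + g t)"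
  then obtain f g where f: "smooth_on I f" "smooth_on I g" "h = (\<lambda>t. f t + g t)" by blast
  obtain f' where "smooth_on I f'" "\<And>t. t \<in> I \<Longrightarrow> (f has_vector_derivative f' t) (at t within I)"
    using smooth_on_derivE[OF f(1)] by blast
  moreover obtain g' where "smooth_on I g'" "\<And>t. t \<in> I \<Longrightarrow> (g has_vector_derivative g' t) (at t within I)"
    using smooth_on_derivE[OF f(2)] by blast
  ultimately show "\<exists>h'. (\<exists>f g. smooth_on I f \<and> smooth_on I g \<and> h' = (\<lambda>t. f t + g t)) \<and>
      (\<forall>t\<in>I. (h has_vector_derivative h' t) (at t within I))"
    unfolding f(3) using has_vector_derivative_add by blast
qed (use assms in blast)

text \<open>The Leibniz rule leads out of the class of single products but not out of their finite
  sums, which therefore serve as the invariant class.\<close>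

inductive scaleR_sum :: "real set \<Rightarrow> (real \<Rightarrow> 'a::real_normed_vector) \<Rightarrow> bool" for I where
  scaleR: "smooth_on I f \<Longrightarrow> smooth_on I g \<Longrightarrow> scaleR_sum I (\<lambda>t. f t *\<^sub>R g t)"
| add: "scaleR_sum I f \<Longrightarrow> scaleR_sum I g \<Longrightarrow> scaleR_sum I (\<lambda>t. f t + g t)"

lemma smooth_on_scaleR:
  assumes "smooth_on I f" "smooth_on I g"
  shows "smooth_on I (\<lambda>t. f t *\<^sub>R g t)"
proof (rule smooth_on_coinduct[where P = "scaleR_sum I"])
  fix h :: "real \<Rightarrow> 'a" assume "scaleR_sum I h"
  then show "\<exists>h'. scaleR_sum I h' \<and> (\<forall>t\<in>I. (h has_vector_derivative h' t) (at t within I))"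
  proof induction
    case (scaleR f g)
    obtain f' where f': "smooth_on I f'" "\<And>t. t \<in> I \<Longrightarrow> (f has_vector_derivative f' t) (at t within I)"
      using smooth_on_derivE[OF scaleR(1)] by blast
    moreover obtain g' where g': "smooth_on I g'" "\<And>t. t \<in> I \<Longrightarrow> (g has_vector_derivative g' t) (at t within I)"
      using smooth_on_derivE[OF scaleR(2)] by blast
    ultimately have "((\<lambda>t. f t *\<^sub>R g t) has_vector_derivative f t *\<^sub>R g' t + f' t *\<^sub>R g t) (at t within I)"
      if "t \<in> I" for t
      using that by (intro has_vector_derivative_scaleR)
        (auto simp: has_real_derivative_iff_has_vector_derivative)
    moreover have "scaleR_sum I (\<lambda>t. f t *\<^sub>R g' t + f' t *\<^sub>R g t)"
      by (intro scaleR_sum.intros scaleR f' g')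
    ultimately show ?case by blast
  next
    case (add f g)
    then obtain f' g' where "scaleR_sum I f'" "scaleR_sum I g'"
      "\<forall>t\<in>I. (f has_vector_derivative f' t) (at t within I)"
      "\<forall>t\<in>I. (g has_vector_derivative g' t) (at t within I)" by blast
    then show ?case
      by (intro exI[of _ "\<lambda>t. f' t + g' t"]) (auto intro: scaleR_sum.add has_vector_derivative_add)
  qed
qed (intro scaleR_sum.intros assms)

lemma smooth_on_mult:
  fixes f g :: "real \<Rightarrow> real"
  shows "smooth_on I f \<Longrightarrow> smooth_on I g \<Longrightarrow> smooth_on I (\<lambda>t. f t * g t)"
  using smooth_on_scaleR[of I f g] by simp

lemma smooth_on_power:
  fixes f :: "real \<Rightarrow> real"
  assumes "smooth_on I f"
  shows "smooth_on I (\<lambda>t. f t ^ n)"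
  by (induction n) (auto intro: smooth_on_const smooth_on_mult assms)

text \<open>The class of quotients \<open>f / q ^ n\<close> is invariant: the derivative has
  numerator \<open>f' * q - n * f * q'\<close> and exponent n + 1.\<close>

lemma smooth_on_inverse:
  fixes q :: "real \<Rightarrow> real"
  assumes q: "smooth_on I q" and nz: "\<And>t. t \<in> I \<Longrightarrow> q t \<noteq> 0"
  shows "smooth_on I (\<lambda>t. inverse (q t))"
proof (rule smooth_on_coinduct[where P = "\<lambda>g. \<exists>f n. smooth_on I f \<and> g = (\<lambda>t. f t * inverse (q t) ^ n)"])
  fix g assume "\<exists>f n. smooth_on I f \<and> g = (\<lambda>t. f t * inverse (q t) ^ n)"
  then obtain f n where f: "smooth_on I f" and g: "g = (\<lambda>t. f t * inverse (q t) ^ n)" by blast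
  obtain f' where f': "smooth_on I f'" "\<And>t. t \<in> I \<Longrightarrow> (f has_real_derivative f' t) (at t within I)"
    using smooth_on_derivE[OF f] unfolding has_real_derivative_iff_has_vector_derivative by blast
  obtain q' where q': "smooth_on I q'" "\<And>t. t \<in> I \<Longrightarrow> (q has_real_derivative q' t) (at t within I)"
    using smooth_on_derivE[OF q] unfolding has_real_derivative_iff_has_vector_derivative by blast
  define h where "h = (\<lambda>t. f' t * q t + (- real n) * (f t * q' t))"
  have "smooth_on I h"
    unfolding h_def by (intro smooth_on_add smooth_on_mult smooth_on_const f f' q q')
  moreover have "(g has_real_derivative h t * inverse (q t) ^ Suc n) (at t within I)" if t: "t \<in> I" for t
  proof -
    have "(g has_real_derivative f' t * inverse (q t) ^ n +
        f t * (real n * inverse (q t) ^ (n - 1) * (- (q' t) * inverse (q t) ^ 2))) (at t within I)"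
      unfolding g using t nz[OF t]
      by (auto intro!: derivative_eq_intros f' q' simp: power2_eq_square algebra_simps)
    \<comment> \<open>At n = 0 the truncated exponent \<open>n - 1\<close> does no harm because of
      the factor \<open>real n\<close>; hence the case split.\<close>
    moreover have "f' t * inverse (q t) ^ n +
        f t * (real n * inverse (q t) ^ (n - 1) * (- (q' t) * inverse (q t) ^ 2)) = h t * inverse (q t) ^ Suc n"
      using nz[OF t] by (cases n) (auto simp: h_def field_simps power2_eq_square)
    ultimately show ?thesis by simp
  qed
  ultimately show "\<exists>g'. (\<exists>f n. smooth_on I f \<and> g' = (\<lambda>t. f t * inverse (q t) ^ n)) \<and>
      (\<forall>t\<in>I. (g has_vector_derivative g' t) (at t within I))"
    unfolding has_real_derivative_iff_has_vector_derivative by blast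
next
  show "\<exists>f n. smooth_on I f \<and> (\<lambda>t. inverse (q t)) = (\<lambda>t. f t * inverse (q t) ^ n)"
    by (rule exI[of _ "\<lambda>_. 1"], rule exI[of _ 1]) (auto intro: smooth_on_const)
qed

text \<open>The class of products \<open>f * sqrt q\<close> is invariant, since
  \<open>sqrt q\<close> has derivative \<open>q' / (2 * q) * sqrt q\<close>.\<close>

lemma smooth_on_sqrt:
  fixes q :: "real \<Rightarrow> real"
  assumes q: "smooth_on I q" and pos: "\<And>t. t \<in> I \<Longrightarrow> q t > 0"
  shows "smooth_on I (\<lambda>t. sqrt (q t))"
proof (rule smooth_on_coinduct[where P = "\<lambda>g. \<exists>f. smooth_on I f \<and> g = (\<lambda>t. f t * sqrt (q t))"])
  fix g assume "\<exists>f. smooth_on I f \<and> g = (\<lambda>t. f t * sqrt (q t))"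
  then obtain f where f: "smooth_on I f" and g: "g = (\<lambda>t. f t * sqrt (q t))" by blast
  obtain f' where f': "smooth_on I f'" "\<And>t. t \<in> I \<Longrightarrow> (f has_real_derivative f' t) (at t within I)"
    using smooth_on_derivE[OF f] unfolding has_real_derivative_iff_has_vector_derivative by blast
  obtain q' where q': "smooth_on I q'" "\<And>t. t \<in> I \<Longrightarrow> (q has_real_derivative q' t) (at t within I)"
    using smooth_on_derivE[OF q] unfolding has_real_derivative_iff_has_vector_derivative by blast
  define h where "h = (\<lambda>t. f' t + f t * (q' t * inverse (2 * q t)))"
  have "q t \<noteq> 0" if "t \<in> I" for t using pos[OF that] by simp
  then have "smooth_on I h"
    unfolding h_def by (intro smooth_on_add smooth_on_mult smooth_on_inverse smooth_on_const f f' q q') auto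
  moreover have "(g has_real_derivative h t * sqrt (q t)) (at t within I)" if t: "t \<in> I" for t
  proof -
    have "(g has_real_derivative f' t * sqrt (q t) + f t * (q' t * (inverse (sqrt (q t)) / 2))) (at t within I)"
      unfolding g using t pos[OF t]
      by (auto intro!: derivative_eq_intros f' q')
    moreover have "inverse (sqrt (q t)) / 2 = inverse (2 * q t) * sqrt (q t)"
      using pos[OF t] by (simp add: field_simps)
    ultimately show ?thesis by (simp add: h_def algebra_simps)
  qed
  ultimately show "\<exists>g'. (\<exists>f. smooth_on I f \<and> g' = (\<lambda>t. f t * sqrt (q t))) \<and>
      (\<forall>t\<in>I. (g has_vector_derivative g' t) (at t within I))"
    unfolding has_real_derivative_iff_has_vector_derivative by blast
next
  show "\<exists>f. smooth_on I f \<and> (\<lambda>t. sqrt (q t)) = (\<lambda>t. f t * sqrt (q t))"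
    by (rule exI[of _ "\<lambda>_. 1"]) (auto intro: smooth_on_const)
qed

lemma smooth_on_norm_complex:
  fixes f :: "real \<Rightarrow> complex"
  assumes f: "smooth_on I f" and nz: "\<And>t. t \<in> I \<Longrightarrow> f t \<noteq> 0"
  shows "smooth_on I (\<lambda>t. norm (f t))"
proof -
  have "(Re (f t))\<^sup>2 + (Im (f t))\<^sup>2 > 0" if "t \<in> I" for t
    using nz[OF that] by (simp add: complex_neq_0)
  then show ?thesis
    unfolding norm_complex_def
    by (intro smooth_on_sqrt smooth_on_add smooth_on_power
        smooth_on_linear[OF bounded_linear_Re] smooth_on_linear[OF bounded_linear_Im] f)
qed

text \<open>The derivative of \<open>f \<circ> \<phi>\<close> is
  \<open>(f' / q) \<circ> \<phi>\<close>, again a smooth function composed with \<phi>. The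
  hypothesis is the equation satisfied by the inverse of a map with derivative \<open>q\<close>; q =
  1 gives translations.\<close>

lemma smooth_on_compose_inverse:
  assumes f: "smooth_on I f" and q: "smooth_on I q" and nz: "\<And>t. t \<in> I \<Longrightarrow> q t \<noteq> 0"
    and \<phi>: "\<And>x. x \<in> J \<Longrightarrow> \<phi> x \<in> I"
      "\<And>x. x \<in> J \<Longrightarrow> (\<phi> has_real_derivative inverse (q (\<phi> x))) (at x within J)"
  shows "smooth_on J (\<lambda>x. f (\<phi> x))"
proof (rule smooth_on_coinduct[where P = "\<lambda>g. \<exists>f. smooth_on I f \<and> g = (\<lambda>x. f (\<phi> x))"])
  fix g assume "\<exists>f. smooth_on I f \<and> g = (\<lambda>x. f (\<phi> x))"
  then obtain f where f: "smooth_on I f" and g: "g = (\<lambda>x. f (\<phi> x))" by blast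
  obtain f' where f': "smooth_on I f'" "\<And>t. t \<in> I \<Longrightarrow> (f has_vector_derivative f' t) (at t within I)"
    using smooth_on_derivE[OF f] by blast
  have "(g has_vector_derivative inverse (q (\<phi> x)) *\<^sub>R f' (\<phi> x)) (at x within J)" if x: "x \<in> J" for x
    using vector_diff_chain_within[of \<phi> "inverse (q (\<phi> x))" x J f "f' (\<phi> x)"] \<phi> f'(2) x
    by (auto simp: g o_def has_real_derivative_iff_has_vector_derivative
        intro!: has_vector_derivative_within_subset[of f "f' (\<phi> x)" "\<phi> x" I "\<phi> ` J"])
  moreover have "smooth_on I (\<lambda>t. inverse (q t) *\<^sub>R f' t)"
    by (intro smooth_on_scaleR smooth_on_inverse q nz f')
  ultimately show "\<exists>g'. (\<exists>f. smooth_on I f \<and> g' = (\<lambda>x. f (\<phi> x))) \<and>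
      (\<forall>t\<in>J. (g has_vector_derivative g' t) (at t within J))"
    by (intro exI[of _ "\<lambda>x. inverse (q (\<phi> x)) *\<^sub>R f' (\<phi> x)"]) blast
qed (use f in blast)

subsection \<open>Arc length and curvature\<close>

definition acceleration :: "pcurve \<Rightarrow> real \<Rightarrow> complex" where
  "acceleration \<gamma> t = vector_derivative (velocity \<gamma>) (at t within cdomain \<gamma>)"

lemma interval_at_within_neq_bot:
  fixes I :: "real set"
  assumes "is_interval I" "\<exists>x\<in>I. \<exists>y\<in>I. x < y" "t \<in> I"
  shows "at t within I \<noteq> bot"
proof -
  have "t islimpt I"
    using assms by (intro connected_imp_perfect) (auto simp: is_interval_connected_1[symmetric])
  then show ?thesis by (simp add: trivial_limit_within)
qed

lemma is_curve_at_within_neq_bot: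
  assumes "is_curve \<gamma>" "t \<in> cdomain \<gamma>"
  shows "at t within cdomain \<gamma> \<noteq> bot"
  using assms unfolding is_curve_def by (intro interval_at_within_neq_bot) auto

lemma velocityI:
  assumes "is_curve \<gamma>" "t \<in> cdomain \<gamma>" "(cmap \<gamma> has_vector_derivative v) (at t within cdomain \<gamma>)"
  shows "velocity \<gamma> t = v"
  unfolding velocity_def by (intro vector_derivative_within is_curve_at_within_neq_bot assms)

lemma accelerationI:
  assumes "is_curve \<gamma>" "t \<in> cdomain \<gamma>" "(velocity \<gamma> has_vector_derivative a) (at t within cdomain \<gamma>)"
  shows "acceleration \<gamma> t = a"
  unfolding acceleration_def by (intro vector_derivative_within is_curve_at_within_neq_bot assms)

lemma smooth_on_velocity:
  assumes "is_curve \<gamma>"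
  shows "smooth_on (cdomain \<gamma>) (velocity \<gamma>)"
    and "t \<in> cdomain \<gamma> \<Longrightarrow> (cmap \<gamma> has_vector_derivative velocity \<gamma> t) (at t within cdomain \<gamma>)"
proof -
  obtain v where v: "smooth_on (cdomain \<gamma>) v"
    "\<And>t. t \<in> cdomain \<gamma> \<Longrightarrow> (cmap \<gamma> has_vector_derivative v t) (at t within cdomain \<gamma>)"
    using assms unfolding is_curve_def by (meson smooth_on_derivE)
  then have eq: "\<And>t. t \<in> cdomain \<gamma> \<Longrightarrow> v t = velocity \<gamma> t"
    using velocityI[OF assms] by metis
  show "smooth_on (cdomain \<gamma>) (velocity \<gamma>)"
    using smooth_on_cong[OF eq v(1)] by blast
  show "t \<in> cdomain \<gamma> \<Longrightarrow> (cmap \<gamma> has_vector_derivative velocity \<gamma> t) (at t within cdomain \<gamma>)"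
    using v(2) eq by metis
qed

lemma has_vector_derivative_velocity:
  assumes "is_curve \<gamma>" "t \<in> cdomain \<gamma>"
  shows "(velocity \<gamma> has_vector_derivative acceleration \<gamma> t) (at t within cdomain \<gamma>)"
  using smooth_on_derivE[OF smooth_on_velocity(1)[OF assms(1)]] accelerationI[OF assms] assms(2)
  by metis

lemma velocity_nonzero: "is_curve \<gamma> \<Longrightarrow> t \<in> cdomain \<gamma> \<Longrightarrow> velocity \<gamma> t \<noteq> 0"
  unfolding is_curve_def by blast

lemma convex_cdomain: "is_curve \<gamma> \<Longrightarrow> convex (cdomain \<gamma>)"
  unfolding is_curve_def by (simp add: is_interval_convex_1)

lemma cbase_in_cdomain: "is_curve \<gamma> \<Longrightarrow> cbase \<gamma> \<in> cdomain \<gamma>"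
  unfolding is_curve_def by blast

text \<open>Arg is the imaginary part of Ln, and the quotient of velocities equals 1 at
  \<open>u = t\<close>, where Ln is differentiable with derivative 1. All later computations use
  this formula instead of Arg.\<close>

lemma curvature_eq:
  assumes "is_curve \<gamma>" "t \<in> cdomain \<gamma>"
  shows "curvature \<gamma> t = Im (acceleration \<gamma> t / velocity \<gamma> t) / norm (velocity \<gamma> t)"
proof -
  define I where "I = cdomain \<gamma>"
  define v where "v = velocity \<gamma>"
  have nz: "v u \<noteq> 0" if "u \<in> I" for u
    using that velocity_nonzero[OF assms(1)] by (simp add: v_def I_def)
  have t: "t \<in> I" using assms(2) by (simp add: I_def)
  have "((\<lambda>u. v u / v t) has_vector_derivative acceleration \<gamma> t / v t) (at t within I)"
    using has_vector_derivative_velocity[OF assms] unfolding I_def v_def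
    by (rule has_vector_derivative_divide)
  moreover have "(Ln has_field_derivative 1) (at (v t / v t) within (\<lambda>u. v u / v t) ` I)"
    using nz[OF t] has_field_derivative_Ln[of 1] by (auto intro: has_field_derivative_at_within)
  ultimately have "((Ln \<circ> (\<lambda>u. v u / v t)) has_vector_derivative acceleration \<gamma> t / v t * 1) (at t within I)"
    by (rule field_vector_diff_chain_within)
  then have "((\<lambda>u. Im (Ln (v u / v t))) has_vector_derivative Im (acceleration \<gamma> t / v t)) (at t within I)"
    using bounded_linear.has_vector_derivative[OF bounded_linear_Im] by (fastforce simp: o_def)
  then have "((\<lambda>u. Arg (v u / v t)) has_vector_derivative Im (acceleration \<gamma> t / v t)) (at t within I)"
    by (rule has_vector_derivative_transform[OF t, rotated])
      (use nz t in \<open>simp add: Arg_eq_Im_Ln\<close>)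
  then have "vector_derivative (\<lambda>u. Arg (v u / v t)) (at t within I) = Im (acceleration \<gamma> t / v t)"
    using is_curve_at_within_neq_bot[OF assms] by (intro vector_derivative_within) (auto simp: I_def)
  then show ?thesis unfolding curvature_def I_def v_def by simp
qed

lemma smooth_on_speed:
  assumes "is_curve \<gamma>"
  shows "smooth_on (cdomain \<gamma>) (\<lambda>t. norm (velocity \<gamma> t))"
  by (intro smooth_on_norm_complex smooth_on_velocity velocity_nonzero assms)

text \<open>Reduction to a compact interval \<open>{a..b}\<close> inside \<open>I\<close> that
  contains \<open>c\<close> and \<open>t\<close> and coincides with \<open>I\<close> near
  \<open>t\<close>, so that both give the same derivative, one-sided at an endpoint.\<close>

lemma interval_integral_has_real_derivative:
  fixes f :: "real \<Rightarrow> real" and c :: real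
  assumes I: "is_interval I" and c: "c \<in> I" and t: "t \<in> I" and f: "continuous_on I f"
  shows "((\<lambda>u. LBINT y=c..u. f y) has_real_derivative f t) (at t within I)"
proof -
  \<comment> \<open>If \<open>t\<close> is the least point of \<open>I\<close>, then
    \<open>a = t\<close> and any \<open>l < t\<close> will do; otherwise a point
    \<open>x < t\<close> of \<open>I\<close> supplies both.\<close>
  obtain a l where a: "a \<in> I" "a \<le> c" "a \<le> t" "l < t" "\<And>x. x \<in> I \<Longrightarrow> l < x \<Longrightarrow> a \<le> x"
  proof (cases "\<exists>x\<in>I. x < t")
    case True
    then obtain x where "x \<in> I" "x < t" by blast
    then show thesis using that[of "min x c" x] c by (auto simp: min_def)
  next
    case False
    then show thesis using that[of t "t - 1"] t c by force
  qed
  obtain b u where b: "b \<in> I" "c \<le> b" "t \<le> b" "t < u" "\<And>x. x \<in> I \<Longrightarrow> x < u \<Longrightarrow> x \<le> b"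
  proof (cases "\<exists>x\<in>I. t < x")
    case True
    then obtain x where "x \<in> I" "t < x" by blast
    then show thesis using that[of "max x c" x] c by (auto simp: max_def)
  next
    case False
    then show thesis using that[of t "t + 1"] t c by force
  qed
  have sub: "{a..b} \<subseteq> I"
    using I a(1) b(1) unfolding is_interval_1 by (meson atLeastAtMost_iff subsetI)
  have "((\<lambda>u. LBINT y=c..u. f y) has_vector_derivative f t) (at t within {a..b})"
    using a b by (intro interval_integral_FTC2 continuous_on_subset[OF f sub]) auto
  moreover have "at t within {a..b} = at t within I"
    using a b sub by (intro at_within_nhd[of t "{l<..<u}"]) auto
  ultimately show ?thesis by (simp add: has_real_derivative_iff_has_vector_derivative)
qed

lemma arclength_base [simp]: "arclength \<gamma> (cbase \<gamma>) = 0"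
  by (simp add: arclength_def)

lemma has_real_derivative_arclength:
  assumes "is_curve \<gamma>" "t \<in> cdomain \<gamma>"
  shows "(arclength \<gamma> has_real_derivative norm (velocity \<gamma> t)) (at t within cdomain \<gamma>)"
  unfolding arclength_def[abs_def]
  using assms smooth_on_continuous_on[OF smooth_on_speed[OF assms(1)]]
  by (intro interval_integral_has_real_derivative) (auto simp: is_curve_def)

text \<open>Antiderivatives on an interval differ by a constant, and the arc length vanishes at the
  base point. This replaces every substitution in an integral.\<close>

lemma arclength_unique:
  assumes "is_curve \<gamma>"
    and F: "\<And>t. t \<in> cdomain \<gamma> \<Longrightarrow> (F has_real_derivative norm (velocity \<gamma> t)) (at t within cdomain \<gamma>)"
    and t: "t \<in> cdomain \<gamma>"
  shows "arclength \<gamma> t = F t - F (cbase \<gamma>)"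
proof -
  have "((\<lambda>t. arclength \<gamma> t - F t) has_vector_derivative 0) (at t within cdomain \<gamma>)" if "t \<in> cdomain \<gamma>" for t
    using DERIV_diff[OF has_real_derivative_arclength[OF assms(1) that] F[OF that]]
    by (simp add: has_real_derivative_iff_has_vector_derivative)
  then obtain c where c: "\<And>t. t \<in> cdomain \<gamma> \<Longrightarrow> arclength \<gamma> t - F t = c"
    using has_vector_derivative_zero_constant[OF convex_cdomain[OF assms(1)]] by blast
  show ?thesis
    using c[OF t] c[OF cbase_in_cdomain[OF assms(1)]] by simp
qed

lemma smooth_on_arclength:
  assumes "is_curve \<gamma>"
  shows "smooth_on (cdomain \<gamma>) (arclength \<gamma>)"
  using smooth_on_antideriv[OF smooth_on_speed[OF assms]] has_real_derivative_arclength[OF assms]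
  unfolding has_real_derivative_iff_has_vector_derivative by blast

section \<open>Arc length and curvature under reparametrization\<close>

lemma continuous_nonzero_sgn_const:
  fixes q :: "real \<Rightarrow> real"
  assumes "connected I" "continuous_on I q" "\<And>t. t \<in> I \<Longrightarrow> q t \<noteq> 0" "a \<in> I" "b \<in> I"
  shows "sgn (q a) = sgn (q b)"
proof -
  have "connected (q ` I)" using assms(1,2) by (rule connected_continuous_image[rotated])
  then have ivl: "is_interval (q ` I)" by (simp add: is_interval_connected_1)
  have "0 \<notin> q ` I" using assms(3) by force
  moreover have "q a \<in> q ` I" "q b \<in> q ` I" using assms by auto
  ultimately show ?thesis
    using ivl unfolding is_interval_1 by (smt (verit, best) sgn_real_def)
qed

lemma sgn_const_on:
  fixes q :: "real \<Rightarrow> real"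
  assumes "connected I" "continuous_on I q" "\<And>t. t \<in> I \<Longrightarrow> q t \<noteq> 0" "I \<noteq> {}"
  obtains \<sigma> where "\<sigma> \<in> {1, -1}" "\<And>t. t \<in> I \<Longrightarrow> sgn (q t) = \<sigma>"
proof -
  obtain a where a: "a \<in> I" using assms(4) by blast
  have "sgn (q a) \<in> {1, -1}" using assms(3)[OF a] by (auto simp: sgn_real_def)
  then show thesis using that continuous_nonzero_sgn_const[OF assms(1-3) _ a] by blast
qed

text \<open>A reparametrization may reverse the orientation, which changes the sign of both the arc
  length and the curvature.\<close>

lemma reparametrization_invariants:
  assumes \<gamma>: "is_curve \<gamma>" and \<gamma>': "is_curve \<gamma>'" and rep: "reparametrization \<gamma> \<gamma>' t"
  obtains \<sigma> :: real where "\<sigma> \<in> {1, -1}"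
    "\<And>u. u \<in> cdomain \<gamma> \<Longrightarrow> arclength \<gamma> u = \<sigma> * arclength \<gamma>' (t u)"
    "\<And>u. u \<in> cdomain \<gamma> \<Longrightarrow> curvature \<gamma> u = \<sigma> * curvature \<gamma>' (t u)"
proof -
  define I where "I = cdomain \<gamma>"
  define J where "J = cdomain \<gamma>'"
  have t: "smooth_on I t" "t (cbase \<gamma>) = cbase \<gamma>'" "t ` I = J"
    and eq: "\<And>u. u \<in> I \<Longrightarrow> cmap \<gamma> u = cmap \<gamma>' (t u)"
    using rep unfolding reparametrization_def I_def J_def homeomorphism_def by auto
  obtain q where q: "smooth_on I q" "\<And>u. u \<in> I \<Longrightarrow> (t has_vector_derivative q u) (at u within I)"
    using smooth_on_derivE[OF t(1)] by blast
  obtain r where r: "smooth_on I r" "\<And>u. u \<in> I \<Longrightarrow> (q has_vector_derivative r u) (at u within I)"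
    using smooth_on_derivE[OF q(1)] by blast
  have tJ: "t u \<in> cdomain \<gamma>'" if "u \<in> I" for u using t(3) that J_def by blast
  have vel: "velocity \<gamma> u = q u *\<^sub>R velocity \<gamma>' (t u)" if u: "u \<in> I" for u
  proof -
    have "((cmap \<gamma>' \<circ> t) has_vector_derivative q u *\<^sub>R velocity \<gamma>' (t u)) (at u within I)"
      using smooth_on_velocity(2)[OF \<gamma>' tJ[OF u]] t(3)
      by (intro vector_diff_chain_within q u) (simp add: J_def)
    then have "(cmap \<gamma> has_vector_derivative q u *\<^sub>R velocity \<gamma>' (t u)) (at u within I)"
      by (rule has_vector_derivative_transform[OF u, rotated]) (simp add: eq)
    then show ?thesis using velocityI[OF \<gamma>] u by (simp add: I_def)
  qed
  \<comment> \<open>A reparametrization is only a smooth homeomorphism, whose derivative might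
    vanish; the chain rule excludes this because the velocity of \<gamma> does not vanish.\<close>
  have nz: "q u \<noteq> 0" if u: "u \<in> I" for u
    using velocity_nonzero[OF \<gamma>] vel[OF u] u by (auto simp: I_def)
  have acc: "acceleration \<gamma> u =
      q u *\<^sub>R q u *\<^sub>R acceleration \<gamma>' (t u) + r u *\<^sub>R velocity \<gamma>' (t u)" if u: "u \<in> I" for u
  proof -
    have "((velocity \<gamma>' \<circ> t) has_vector_derivative q u *\<^sub>R acceleration \<gamma>' (t u)) (at u within I)"
      using has_vector_derivative_velocity[OF \<gamma>' tJ[OF u]] t(3)
      by (intro vector_diff_chain_within q u) (simp add: J_def)
    then have "((\<lambda>u. q u *\<^sub>R velocity \<gamma>' (t u)) has_vector_derivative
        q u *\<^sub>R q u *\<^sub>R acceleration \<gamma>' (t u) + r u *\<^sub>R velocity \<gamma>' (t u)) (at u within I)"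
      using r(2)[OF u] by (intro has_vector_derivative_scaleR)
        (auto simp: o_def has_real_derivative_iff_has_vector_derivative)
    then have "(velocity \<gamma> has_vector_derivative
        q u *\<^sub>R q u *\<^sub>R acceleration \<gamma>' (t u) + r u *\<^sub>R velocity \<gamma>' (t u)) (at u within I)"
      by (rule has_vector_derivative_transform[OF u, rotated]) (simp add: vel)
    then show ?thesis using accelerationI[OF \<gamma>] u by (simp add: I_def)
  qed
  have "connected I" "I \<noteq> {}"
    using \<gamma> by (auto simp: I_def is_curve_def is_interval_connected_1)
  then obtain \<sigma> where \<sigma>: "\<sigma> \<in> {1, -1}" "\<And>u. u \<in> I \<Longrightarrow> sgn (q u) = \<sigma>"
    using sgn_const_on smooth_on_continuous_on[OF q(1)] nz by metis
  have "curvature \<gamma> u = \<sigma> * curvature \<gamma>' (t u)" if u: "u \<in> I" for u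
  proof -
    have v: "velocity \<gamma>' (t u) \<noteq> 0" using velocity_nonzero[OF \<gamma>' tJ[OF u]] .
    \<comment> \<open>The tangential contribution of the second derivative of \<open>t\<close> is
      the real number \<open>r u / q u\<close> and drops out of the imaginary part.\<close>
    have "acceleration \<gamma> u / velocity \<gamma> u =
        q u *\<^sub>R (acceleration \<gamma>' (t u) / velocity \<gamma>' (t u)) + complex_of_real (r u / q u)"
      using v nz[OF u] unfolding vel[OF u] acc[OF u] scaleR_conv_of_real by (simp add: field_simps)
    then have im: "Im (acceleration \<gamma> u / velocity \<gamma> u) = q u * Im (acceleration \<gamma>' (t u) / velocity \<gamma>' (t u))"
      by (simp only: plus_complex.sel scaleR_complex.sel Im_complex_of_real add_0_right)
    have "curvature \<gamma> u = q u / \<bar>q u\<bar> * curvature \<gamma>' (t u)"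
      using curvature_eq[OF \<gamma>, of u] curvature_eq[OF \<gamma>' tJ[OF u]] u im vel[OF u]
      by (simp add: I_def)
    also have "q u / \<bar>q u\<bar> = \<sigma>" using \<sigma>(2)[OF u] nz[OF u] by (auto simp: sgn_real_def abs_if split: if_splits)
    finally show ?thesis .
  qed
  moreover have "arclength \<gamma> u = \<sigma> * arclength \<gamma>' (t u)" if u: "u \<in> I" for u
  proof -
    have "((\<lambda>u. \<sigma> * arclength \<gamma>' (t u)) has_real_derivative norm (velocity \<gamma> u)) (at u within I)"
      if u: "u \<in> I" for u
    proof -
      have "((arclength \<gamma>' \<circ> t) has_vector_derivative q u *\<^sub>R norm (velocity \<gamma>' (t u))) (at u within I)"
        using has_real_derivative_arclength[OF \<gamma>' tJ[OF u]] t(3)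
        by (intro vector_diff_chain_within q u) (simp add: J_def has_real_derivative_iff_has_vector_derivative)
      then have "((\<lambda>u. arclength \<gamma>' (t u)) has_real_derivative q u * norm (velocity \<gamma>' (t u))) (at u within I)"
        by (simp add: o_def has_real_derivative_iff_has_vector_derivative)
      from DERIV_cmult[OF this, of \<sigma>] show ?thesis
        using \<sigma>(2)[OF u] nz[OF u] vel[OF u] by (simp add: mult.assoc[symmetric] abs_sgn mult.commute[of \<sigma>])
    qed
    from arclength_unique[OF \<gamma>, of "\<lambda>u. \<sigma> * arclength \<gamma>' (t u)" u] this u show ?thesis
      by (simp add: I_def t(2))
  qed
  ultimately show thesis using that \<sigma>(1) unfolding I_def by blast
qed

section \<open>Shifted curves\<close>

lemma cdomain_shift: "cdomain (shift \<epsilon> \<gamma>) = (\<lambda>t. t - \<epsilon>) ` cdomain \<gamma>"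
  by (simp add: shift_def)

lemma shift_simps [simp]:
  "cmap (shift \<epsilon> \<gamma>) = (\<lambda>t. cmap \<gamma> (t + \<epsilon>))"
  "cbase (shift \<epsilon> \<gamma>) = cbase \<gamma>"
  by (simp_all add: shift_def)

lemma mem_cdomain_shift: "t \<in> cdomain (shift \<epsilon> \<gamma>) \<longleftrightarrow> t + \<epsilon> \<in> cdomain \<gamma>"
  by (auto simp: cdomain_shift image_iff) force

lemma has_vector_derivative_shift:
  assumes "(f has_vector_derivative d) (at (t + \<epsilon>) within I)"
  shows "((\<lambda>t. f (t + \<epsilon>)) has_vector_derivative d) (at t within (\<lambda>t. t - \<epsilon>) ` I)"
proof -
  have "(\<lambda>t. t + \<epsilon>) ` (\<lambda>t. t - \<epsilon>) ` I = I" by (simp add: image_image)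
  then have "((f \<circ> (\<lambda>t. t + \<epsilon>)) has_vector_derivative 1 *\<^sub>R d) (at t within (\<lambda>t. t - \<epsilon>) ` I)"
    using assms by (intro vector_diff_chain_within) (auto intro!: derivative_eq_intros)
  then show ?thesis by (simp add: o_def)
qed

text \<open>Translation preserves every clause except the last one at stake: the interval moves
  while the base point stays where it is.\<close>

lemma is_curve_shift_iff:
  assumes \<gamma>: "is_curve \<gamma>"
  shows "is_curve (shift \<epsilon> \<gamma>) \<longleftrightarrow> cbase \<gamma> + \<epsilon> \<in> cdomain \<gamma>"
proof
  assume "is_curve (shift \<epsilon> \<gamma>)"
  then show "cbase \<gamma> + \<epsilon> \<in> cdomain \<gamma>"
    using cbase_in_cdomain mem_cdomain_shift by fastforce
next
  assume base: "cbase \<gamma> + \<epsilon> \<in> cdomain \<gamma>"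
  define K where "K = cdomain (shift \<epsilon> \<gamma>)"
  have ivl: "is_interval K"
    using \<gamma> is_interval_translation[of "-\<epsilon>" "cdomain \<gamma>"]
    by (simp add: K_def is_curve_def cdomain_shift)
  have ex: "\<exists>x\<in>K. \<exists>y\<in>K. x < y"
    using \<gamma> unfolding is_curve_def K_def cdomain_shift by force
  have deriv: "(cmap (shift \<epsilon> \<gamma>) has_vector_derivative velocity \<gamma> (t + \<epsilon>)) (at t within K)" if "t \<in> K" for t
    using that smooth_on_velocity(2)[OF \<gamma>, of "t + \<epsilon>"] mem_cdomain_shift
    unfolding K_def cdomain_shift shift_simps by (intro has_vector_derivative_shift) (metis cdomain_shift)
  have smooth: "smooth_on K (\<lambda>t. f (t + \<epsilon>))" if "smooth_on (cdomain \<gamma>) f" for f :: "real \<Rightarrow> complex"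
    by (rule smooth_on_compose_inverse[OF that smooth_on_const[of _ "1::real"]])
      (auto simp: K_def mem_cdomain_shift intro!: derivative_eq_intros)
  have "at t within K \<noteq> bot" if "t \<in> K" for t
    using interval_at_within_neq_bot[OF ivl ex that] .
  then have vel: "velocity (shift \<epsilon> \<gamma>) t = velocity \<gamma> (t + \<epsilon>)" if "t \<in> K" for t
    using that deriv vector_derivative_within unfolding velocity_def[of "shift \<epsilon> \<gamma>"] K_def by blast
  have "smooth_on K (cmap (shift \<epsilon> \<gamma>))"
    using \<gamma> smooth by (simp add: is_curve_def)
  moreover have "\<forall>t\<in>K. velocity (shift \<epsilon> \<gamma>) t \<noteq> 0"
    using vel velocity_nonzero[OF \<gamma>] mem_cdomain_shift unfolding K_def by simp
  moreover have "cbase (shift \<epsilon> \<gamma>) \<in> K"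
    using base by (simp add: K_def mem_cdomain_shift)
  ultimately show "is_curve (shift \<epsilon> \<gamma>)"
    using ivl ex unfolding is_curve_def K_def by blast
qed

text \<open>Since the base point does not move along, the shifted arc length is measured from what
  was the point at \<open>cbase \<gamma> + \<epsilon>\<close>; the curvature has no reference
  point.\<close>

lemma shift_invariants:
  assumes \<gamma>: "is_curve \<gamma>" and base: "cbase \<gamma> + \<epsilon> \<in> cdomain \<gamma>" and t: "t + \<epsilon> \<in> cdomain \<gamma>"
  shows "arclength (shift \<epsilon> \<gamma>) t = arclength \<gamma> (t + \<epsilon>) - arclength \<gamma> (cbase \<gamma> + \<epsilon>)"
    and "curvature (shift \<epsilon> \<gamma>) t = curvature \<gamma> (t + \<epsilon>)"
proof -
  define K where "K = cdomain (shift \<epsilon> \<gamma>)"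
  have sh: "is_curve (shift \<epsilon> \<gamma>)" using base is_curve_shift_iff[OF \<gamma>] by simp
  have mem: "t \<in> K \<longleftrightarrow> t + \<epsilon> \<in> cdomain \<gamma>" for t
    unfolding K_def by (rule mem_cdomain_shift)
  have vel: "velocity (shift \<epsilon> \<gamma>) t = velocity \<gamma> (t + \<epsilon>)" if "t \<in> K" for t
    using that mem smooth_on_velocity(2)[OF \<gamma>]
    by (intro velocityI[OF sh]) (auto simp: K_def cdomain_shift intro!: has_vector_derivative_shift)
  have acc: "acceleration (shift \<epsilon> \<gamma>) t = acceleration \<gamma> (t + \<epsilon>)" if "t \<in> K" for t
  proof (intro accelerationI[OF sh])
    have "((\<lambda>t. velocity \<gamma> (t + \<epsilon>)) has_vector_derivative acceleration \<gamma> (t + \<epsilon>)) (at t within K)"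
      using has_vector_derivative_velocity[OF \<gamma>] that mem
      unfolding K_def cdomain_shift shift_simps by (intro has_vector_derivative_shift) (metis cdomain_shift)
    then show "(velocity (shift \<epsilon> \<gamma>) has_vector_derivative acceleration \<gamma> (t + \<epsilon>)) (at t within cdomain (shift \<epsilon> \<gamma>))"
      unfolding K_def[symmetric]
      by (rule has_vector_derivative_transform[OF that, rotated]) (simp add: vel)
  qed (use that K_def in simp)
  have tK: "t \<in> K" using t mem by simp
  show "curvature (shift \<epsilon> \<gamma>) t = curvature \<gamma> (t + \<epsilon>)"
    using curvature_eq[OF sh, of t] curvature_eq[OF \<gamma> t] tK vel acc by (simp add: K_def)
  have "((\<lambda>t. arclength \<gamma> (t + \<epsilon>)) has_real_derivative norm (velocity (shift \<epsilon> \<gamma>) t)) (at t within K)"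
    if "t \<in> K" for t
    using that has_real_derivative_arclength[OF \<gamma>] mem vel has_vector_derivative_shift[of "arclength \<gamma>"]
    unfolding K_def cdomain_shift has_real_derivative_iff_has_vector_derivative by (metis cdomain_shift)
  from arclength_unique[OF sh, of "\<lambda>t. arclength \<gamma> (t + \<epsilon>)" t] this tK
  show "arclength (shift \<epsilon> \<gamma>) t = arclength \<gamma> (t + \<epsilon>) - arclength \<gamma> (cbase \<gamma> + \<epsilon>)"
    unfolding K_def shift_simps by simp
qed

subsection \<open>Curves of special curvature\<close>

lemma orthogonal_transformation_complex_wedge:
  fixes A :: "complex \<Rightarrow> complex"
  assumes A: "orthogonal_transformation A"
  obtains \<sigma> :: real where "\<sigma> \<in> {1, -1}" "\<And>x y. Im (A x / A y) = \<sigma> * Im (x / y)"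
proof -
  define p where "p = A 1"
  define q where "q = A \<i>"
  have lin: "linear A" using A by (rule orthogonal_transformation_linear)
  have Az: "A z = Re z *\<^sub>R p + Im z *\<^sub>R q" for z
  proof -
    have "z = Re z *\<^sub>R 1 + Im z *\<^sub>R \<i>"
      by (simp add: complex_eq_iff)
    then have "A z = A (Re z *\<^sub>R 1 + Im z *\<^sub>R \<i>)" by (rule arg_cong)
    then show ?thesis
      by (simp only: linear_add[OF lin] linear_scale[OF lin] p_def q_def)
  qed
  have inner: "A x \<bullet> A y = x \<bullet> y" for x y
    using A unfolding orthogonal_transformation_def by blast
  \<comment> \<open>The determinant of \<open>A\<close>. Up to sign, \<open>Im (x / y)\<close> is
    the determinant of x and y divided by \<open>(norm y)\<^sup>2\<close>, so \<open>A\<close>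
    multiplies it by \<sigma>. As the columns are orthonormal, Lagrange's identity gives \<sigma> =
    1 or \<sigma> = -1.\<close>
  define \<sigma> where "\<sigma> = Re p * Im q - Im p * Re q"
  have "Re p * Re p + Im p * Im p = 1" "Re q * Re q + Im q * Im q = 1" "Re p * Re q + Im p * Im q = 0"
    using inner[of 1 1] inner[of "\<i>" "\<i>"] inner[of 1 "\<i>"] by (simp_all add: p_def q_def inner_complex_def)
  then have "\<sigma>\<^sup>2 = 1" unfolding \<sigma>_def power2_eq_square by algebra
  then have "\<sigma> \<in> {1, -1}" by (simp add: power2_eq_1_iff)
  moreover have "Im (A x / A y) = \<sigma> * Im (x / y)" for x y
  proof -
    have "Im (A x) * Re (A y) - Re (A x) * Im (A y) = \<sigma> * (Im x * Re y - Re x * Im y)"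
      unfolding Az \<sigma>_def by (simp add: algebra_simps)
    moreover have "(Re (A y))\<^sup>2 + (Im (A y))\<^sup>2 = (Re y)\<^sup>2 + (Im y)\<^sup>2"
      using orthogonal_transformation_norm[OF A, of y] by (simp add: cmod_power2[symmetric])
    ultimately show ?thesis by (simp add: Im_divide)
  qed
  ultimately show thesis using that by blast
qed

text \<open>Being linear, \<open>A\<close> commutes with differentiation and acts on velocity and
  acceleration; the translation part disappears. The norm is preserved and \<open>Im (a / v)\<close>
  picks up the factor \<sigma>.\<close>

lemma isometry_invariants:
  fixes A :: "complex \<Rightarrow> complex" and b :: complex
  assumes \<gamma>: "is_curve \<gamma>" and A: "orthogonal_transformation A"
    and wedge: "\<And>x y. Im (A x / A y) = \<sigma> * Im (x / y)"
    and t: "t \<in> cdomain \<gamma>"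
  defines "\<gamma>' \<equiv> \<gamma>\<lparr>cmap := (\<lambda>t. A (cmap \<gamma> t) + b)\<rparr>"
  shows "arclength \<gamma>' t = arclength \<gamma> t" and "curvature \<gamma>' t = \<sigma> * curvature \<gamma> t"
proof -
  have lin: "bounded_linear A"
    using orthogonal_transformation_linear[OF A] linear_conv_bounded_linear by blast
  have simps [simp]: "cdomain \<gamma>' = cdomain \<gamma>" "cbase \<gamma>' = cbase \<gamma>"
    "cmap \<gamma>' = (\<lambda>t. A (cmap \<gamma> t) + b)" by (simp_all add: \<gamma>'_def)
  have deriv: "(cmap \<gamma>' has_vector_derivative A (velocity \<gamma> u)) (at u within cdomain \<gamma>)"
    if "u \<in> cdomain \<gamma>" for u
    using bounded_linear.has_vector_derivative[OF lin smooth_on_velocity(2)[OF \<gamma> that]]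
    by (auto intro!: derivative_eq_intros)
  have vel: "velocity \<gamma>' u = A (velocity \<gamma> u)" if u: "u \<in> cdomain \<gamma>" for u
    unfolding velocity_def[of \<gamma>'] using deriv[OF u] is_curve_at_within_neq_bot[OF \<gamma> u]
    by (auto intro: vector_derivative_within)
  have norm [simp]: "norm (A z) = norm z" for z
    using orthogonal_transformation_norm[OF A] .
  have "smooth_on (cdomain \<gamma>) (cmap \<gamma>')"
    using smooth_on_antideriv[OF smooth_on_linear[OF lin smooth_on_velocity(1)[OF \<gamma>]] deriv] .
  moreover have "velocity \<gamma>' u \<noteq> 0" if "u \<in> cdomain \<gamma>" for u
    using velocity_nonzero[OF \<gamma> that] vel[OF that] norm by (metis norm_eq_zero)
  ultimately have \<gamma>': "is_curve \<gamma>'"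
    using \<gamma> unfolding is_curve_def by auto
  have acc: "acceleration \<gamma>' u = A (acceleration \<gamma> u)" if u: "u \<in> cdomain \<gamma>" for u
  proof (rule accelerationI[OF \<gamma>'])
    show "(velocity \<gamma>' has_vector_derivative A (acceleration \<gamma> u)) (at u within cdomain \<gamma>')"
      unfolding simps using bounded_linear.has_vector_derivative[OF lin has_vector_derivative_velocity[OF \<gamma> u]]
      by (rule has_vector_derivative_transform[OF u, rotated]) (simp add: vel)
  qed (use u in simp)
  show "curvature \<gamma>' t = \<sigma> * curvature \<gamma> t"
    using curvature_eq[OF \<gamma>', of t] curvature_eq[OF \<gamma> t] t by (simp add: vel acc wedge)
  have "arclength \<gamma>' t = arclength \<gamma> t - arclength \<gamma> (cbase \<gamma>')"
    using has_real_derivative_arclength[OF \<gamma>] t by (intro arclength_unique[OF \<gamma>']) (auto simp: vel)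
  then show "arclength \<gamma>' t = arclength \<gamma> t" by simp
qed

lemma ereal_divide_eq_iff_pos:
  assumes "r > 0"
  shows "1 / ereal k = ereal r \<longleftrightarrow> k = inverse r"
  using assms by (cases "k = 0") (auto simp: divide_ereal_def field_simps)

text \<open>Zeros are included: a vanishing curvature has radius \<infinity>, which a positive
  factor leaves fixed.\<close>

lemma ereal_divide_eq_mult_iff:
  assumes "N > 0"
  shows "1 / ereal x = ereal N * (1 / ereal y) \<longleftrightarrow> x * N = y"
  using assms by (cases "x = 0"; cases "y = 0") (auto simp: divide_ereal_def field_simps)

text \<open>A congruence matters only through its determinant \<sigma>. The positive radius is
  passed to the curvature as the exponential of minus its logarithm, which gives all slopes a common
  shape.\<close>

lemma is_LAC_iff:
  assumes \<gamma>: "is_curve \<gamma>"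
  shows "is_LAC \<gamma> \<longleftrightarrow> (\<exists>\<sigma>\<in>{1, -1}. \<exists>\<alpha> \<xi> \<eta>. \<xi> \<noteq> 0 \<and> (\<forall>t\<in>cdomain \<gamma>.
    (\<alpha> \<noteq> 0 \<longrightarrow> \<xi> * arclength \<gamma> t + \<eta> > 0) \<and>
    \<sigma> * curvature \<gamma> t =
      exp (- (if \<alpha> = 0 then \<xi> * arclength \<gamma> t + \<eta> else ln (\<xi> * arclength \<gamma> t + \<eta>) / \<alpha>))))"
    (is "_ = ?R")
proof -
  have eqn: "lac_equation \<alpha> \<xi> \<eta> (\<gamma>\<lparr>cmap := (\<lambda>t. A (cmap \<gamma> t) + b)\<rparr>) \<longleftrightarrow>
    (\<forall>t\<in>cdomain \<gamma>. (\<alpha> \<noteq> 0 \<longrightarrow> \<xi> * arclength \<gamma> t + \<eta> > 0) \<and>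
      \<sigma> * curvature \<gamma> t =
      exp (- (if \<alpha> = 0 then \<xi> * arclength \<gamma> t + \<eta> else ln (\<xi> * arclength \<gamma> t + \<eta>) / \<alpha>)))"
    if A: "orthogonal_transformation A" "\<And>x y. Im (A x / A y) = \<sigma> * Im (x / y)" for A b \<sigma> \<alpha> \<xi> \<eta>
    unfolding lac_equation_def Let_def curvature_radius_def
    using isometry_invariants[OF \<gamma> A, where b = b]
    by (auto simp: ereal_divide_eq_iff_pos powr_def exp_minus)
  show ?thesis
  proof
    assume "is_LAC \<gamma>"
    then obtain A b \<alpha> \<xi> \<eta> where A: "orthogonal_transformation A" and "\<xi> \<noteq> 0"
      "lac_equation \<alpha> \<xi> \<eta> (\<gamma>\<lparr>cmap := (\<lambda>t. A (cmap \<gamma> t) + b)\<rparr>)"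
      unfolding is_LAC_def by blast
    then show ?R
      using orthogonal_transformation_complex_wedge[OF A] eqn[OF A] by metis
  next
    assume ?R
    then obtain \<sigma> \<alpha> \<xi> \<eta> where \<sigma>: "\<sigma> \<in> {1, -1}" and *: "\<xi> \<noteq> 0"
      "\<forall>t\<in>cdomain \<gamma>. (\<alpha> \<noteq> 0 \<longrightarrow> \<xi> * arclength \<gamma> t + \<eta> > 0) \<and>
      \<sigma> * curvature \<gamma> t =
      exp (- (if \<alpha> = 0 then \<xi> * arclength \<gamma> t + \<eta> else ln (\<xi> * arclength \<gamma> t + \<eta>) / \<alpha>))"
      by blast
    have "\<exists>A. orthogonal_transformation A \<and> (\<forall>x y. Im (A x / A y) = \<sigma> * Im (x / y))"
    proof (cases "\<sigma> = 1")
      case True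
      then show ?thesis by (intro exI[of _ "\<lambda>z. z"]) simp
    next
      case False
      \<comment> \<open>Complex conjugation realizes the sign -1.\<close>
      have "orthogonal_transformation cnj"
        by (auto simp: orthogonal_transformation linear_cnj)
      moreover have "Im (cnj x / cnj y) = \<sigma> * Im (x / y)" for x y
        using False \<sigma> by (simp flip: complex_cnj_divide)
      ultimately show ?thesis by blast
    qed
    then obtain A where "orthogonal_transformation A" "\<And>x y. Im (A x / A y) = \<sigma> * Im (x / y)" by blast
    then show "is_LAC \<gamma>"
      unfolding is_LAC_def using eqn * by blast
  qed
qed

section \<open>Lines and circles in terms of curvature\<close>

text \<open>The Frenet equation \<open>dT/ds = \<i> * \<kappa> * T\<close> in an arbitrary
  parameter: normalizing the velocity removes the real part of the logarithmic derivative a / v and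
  leaves its imaginary part.\<close>

lemma sgn_velocity_has_derivative:
  assumes \<gamma>: "is_curve \<gamma>" and t: "t \<in> cdomain \<gamma>"
  shows "((\<lambda>t. sgn (velocity \<gamma> t)) has_vector_derivative \<i> * curvature \<gamma> t * velocity \<gamma> t)
    (at t within cdomain \<gamma>)"
proof -
  define v where "v = velocity \<gamma>"
  define a where "a = acceleration \<gamma> t"
  have nz: "v t \<noteq> 0" using velocity_nonzero[OF assms] by (simp add: v_def)
  have v: "(v has_vector_derivative a) (at t within cdomain \<gamma>)"
    using has_vector_derivative_velocity[OF assms] by (simp add: v_def a_def)
  have "((norm \<circ> v) has_vector_derivative a \<bullet> sgn (v t)) (at t within cdomain \<gamma>)"
    using vector_derivative_diff_chain_within[OF v has_derivative_at_withinI[OF has_derivative_norm[OF nz]]] .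
  then have "((\<lambda>t. norm (v t)) has_real_derivative a \<bullet> sgn (v t)) (at t within cdomain \<gamma>)"
    by (simp add: o_def has_real_derivative_iff_has_vector_derivative)
  then have "((\<lambda>t. inverse (norm (v t))) has_real_derivative
      - (inverse (norm (v t)) * (a \<bullet> sgn (v t)) * inverse (norm (v t)))) (at t within cdomain \<gamma>)"
    using nz by (intro DERIV_inverse') auto
  then have "((\<lambda>t. inverse (norm (v t)) *\<^sub>R v t) has_vector_derivative
      inverse (norm (v t)) *\<^sub>R a + (- (inverse (norm (v t)) * (a \<bullet> sgn (v t)) * inverse (norm (v t)))) *\<^sub>R v t)
      (at t within cdomain \<gamma>)"
    using v by (rule has_vector_derivative_scaleR)
  \<comment> \<open>The derivative of the speed, written through a / v so that it cancels against
    the real part of that quotient.\<close>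
  moreover have "a \<bullet> sgn (v t) = norm (v t) * Re (a / v t)"
  proof -
    have "Re (a / v t) = (Re a * Re (v t) + Im a * Im (v t)) / (norm (v t))\<^sup>2"
      by (simp add: Re_divide cmod_power2)
    then show ?thesis
      using nz by (simp add: sgn_div_norm inner_complex_def power2_eq_square field_simps)
  qed
  moreover have "inverse (norm (v t)) *\<^sub>R a + (- (inverse (norm (v t)) * (norm (v t) * Re (a / v t)) * inverse (norm (v t)))) *\<^sub>R v t
      = \<i> * curvature \<gamma> t * v t"
  proof -
    have "a = (Re (a / v t) + \<i> * Im (a / v t)) * v t"
      using complex_eq[of "a / v t"] nz by (simp add: field_simps)
    then have "inverse (norm (v t)) *\<^sub>R a = inverse (norm (v t)) *\<^sub>R ((Re (a / v t) + \<i> * Im (a / v t)) * v t)"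
      by simp
    moreover have "complex_of_real (Im (a / v t)) = curvature \<gamma> t * norm (v t)"
      using nz curvature_eq[OF assms] by (simp add: v_def a_def)
    ultimately show ?thesis
      using nz by (simp add: scaleR_conv_of_real field_simps)
  qed
  ultimately show ?thesis
    by (simp add: sgn_div_norm v_def)
qed

text \<open>The division-free formula for the curvature, suited to polynomial elimination.\<close>

lemma curvature_Re_Im:
  assumes "is_curve \<gamma>" "t \<in> cdomain \<gamma>"
  shows "curvature \<gamma> t * norm (velocity \<gamma> t) ^ 3 =
    Re (velocity \<gamma> t) * Im (acceleration \<gamma> t) - Im (velocity \<gamma> t) * Re (acceleration \<gamma> t)"
proof -
  have "Im (acceleration \<gamma> t / velocity \<gamma> t) = (Re (velocity \<gamma> t) * Im (acceleration \<gamma> t) -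
      Im (velocity \<gamma> t) * Re (acceleration \<gamma> t)) / (norm (velocity \<gamma> t))\<^sup>2"
    by (simp add: Im_divide cmod_power2 mult.commute)
  then show ?thesis
    using velocity_nonzero[OF assms] unfolding curvature_eq[OF assms]
    by (simp add: power3_eq_cube power2_eq_square)
qed

lemma has_real_derivative_Re_Im:
  assumes "(f has_vector_derivative d) F"
  shows "((\<lambda>t. Re (f t)) has_real_derivative Re d) F" "((\<lambda>t. Im (f t)) has_real_derivative Im d) F"
  using bounded_linear.has_vector_derivative[OF bounded_linear_Re assms]
    bounded_linear.has_vector_derivative[OF bounded_linear_Im assms]
  by (simp_all add: has_real_derivative_iff_has_vector_derivative)

text \<open>Serves to differentiate the implicit equations of lines and circles along the
  curve.\<close>

lemma derivative_constant_on_curve: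
  assumes \<gamma>: "is_curve \<gamma>" and t: "t \<in> cdomain \<gamma>" and c: "\<And>u. u \<in> cdomain \<gamma> \<Longrightarrow> f u = (c::real)"
    and f: "(f has_real_derivative d) (at t within cdomain \<gamma>)"
  shows "d = 0"
proof -
  have "((\<lambda>_. c) has_vector_derivative d) (at t within cdomain \<gamma>)"
    using f has_vector_derivative_transform[OF t, of "\<lambda>_. c" f d] c
    by (simp add: has_real_derivative_iff_has_vector_derivative)
  from vector_derivative_within[OF is_curve_at_within_neq_bot[OF \<gamma> t] this]
    vector_derivative_within[OF is_curve_at_within_neq_bot[OF \<gamma> t] has_vector_derivative_const]
  show ?thesis by metis
qed

text \<open>On a line, velocity and acceleration are both parallel to its direction. Conversely,
  zero curvature makes the unit tangent T constant, and then so is \<gamma> - s T.\<close>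

lemma is_line_iff_curvature:
  assumes \<gamma>: "is_curve \<gamma>"
  shows "is_line \<gamma> \<longleftrightarrow> (\<forall>t\<in>cdomain \<gamma>. curvature \<gamma> t = 0)"
proof
  assume "is_line \<gamma>"
  then obtain L where L: "aff_dim L = 1" "cmap \<gamma> ` cdomain \<gamma> \<subseteq> L"
    unfolding is_line_def by blast
  then have "collinear L" by (simp add: collinear_aff_dim)
  then obtain w where w: "\<And>x y. x \<in> L \<Longrightarrow> y \<in> L \<Longrightarrow> \<exists>c. x - y = c *\<^sub>R w"
    unfolding collinear_def by blast
  define p where "p = cmap \<gamma> (cbase \<gamma>)"
  have pL: "p \<in> L" using L cbase_in_cdomain[OF \<gamma>] by (auto simp: p_def)
  have "\<exists>c. cmap \<gamma> t - p = c *\<^sub>R w" if "t \<in> cdomain \<gamma>" for t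
    using w pL L(2) that by blast
  then obtain c where c: "\<And>t. t \<in> cdomain \<gamma> \<Longrightarrow> cmap \<gamma> t - p = c t *\<^sub>R w" by metis
  \<comment> \<open>The determinant with the direction \<open>w\<close>; it is constant along the
    line, and differentiating it twice yields \<open>Pv\<close> and \<open>Pa\<close>.\<close>
  define P where "P = (\<lambda>z. Re w * Im z - Im w * Re z)"
  have P: "Re w * Im (cmap \<gamma> t) - Im w * Re (cmap \<gamma> t) = P p" if "t \<in> cdomain \<gamma>" for t
  proof -
    have "cmap \<gamma> t = p + c t *\<^sub>R w" using c[OF that] by (simp add: algebra_simps)
    then show ?thesis by (simp add: P_def algebra_simps)
  qed
  have Pv: "Re w * Im (velocity \<gamma> t) - Im w * Re (velocity \<gamma> t) = 0" if t: "t \<in> cdomain \<gamma>" for t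
    by (rule derivative_constant_on_curve[OF \<gamma> t P])
      (auto intro!: derivative_eq_intros has_real_derivative_Re_Im smooth_on_velocity(2)[OF \<gamma> t])
  have Pa: "Re w * Im (acceleration \<gamma> t) - Im w * Re (acceleration \<gamma> t) = 0" if t: "t \<in> cdomain \<gamma>" for t
    by (rule derivative_constant_on_curve[OF \<gamma> t Pv])
      (auto intro!: derivative_eq_intros has_real_derivative_Re_Im has_vector_derivative_velocity[OF \<gamma> t])
  have "w \<noteq> 0"
  proof
    assume "w = 0"
    then have const: "cmap \<gamma> t = p" if "t \<in> cdomain \<gamma>" for t using c[OF that] by simp
    have b: "cbase \<gamma> \<in> cdomain \<gamma>" using cbase_in_cdomain[OF \<gamma>] .
    have "Re (velocity \<gamma> (cbase \<gamma>)) = 0"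
      by (rule derivative_constant_on_curve[OF \<gamma> b, of "\<lambda>t. Re (cmap \<gamma> t)" "Re p"])
        (auto simp: const intro!: has_real_derivative_Re_Im smooth_on_velocity(2)[OF \<gamma> b])
    moreover have "Im (velocity \<gamma> (cbase \<gamma>)) = 0"
      by (rule derivative_constant_on_curve[OF \<gamma> b, of "\<lambda>t. Im (cmap \<gamma> t)" "Im p"])
        (auto simp: const intro!: has_real_derivative_Re_Im smooth_on_velocity(2)[OF \<gamma> b])
    ultimately show False using velocity_nonzero[OF \<gamma> b] by (simp add: complex_eq_iff)
  qed
  show "\<forall>t\<in>cdomain \<gamma>. curvature \<gamma> t = 0"
  proof
    fix t assume t: "t \<in> cdomain \<gamma>"
    define x y a b where "x = Re (velocity \<gamma> t)" "y = Im (velocity \<gamma> t)"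
      "a = Re (acceleration \<gamma> t)" "b = Im (acceleration \<gamma> t)"
    \<comment> \<open>The determinant of velocity and acceleration, multiplied by either coordinate
      of \<open>w\<close>, is a combination of \<open>Pv\<close> and \<open>Pa\<close>.\<close>
    have "Re w * (x * b - y * a) = 0" "Im w * (x * b - y * a) = 0"
      using Pv[OF t] Pa[OF t] unfolding x_y_a_b_def[symmetric] by algebra+
    then have "x * b - y * a = 0" using \<open>w \<noteq> 0\<close> by (auto simp: complex_eq_iff)
    then show "curvature \<gamma> t = 0"
      using curvature_Re_Im[OF \<gamma> t] velocity_nonzero[OF \<gamma> t] unfolding x_y_a_b_def by simp
  qed
next
  assume zero: "\<forall>t\<in>cdomain \<gamma>. curvature \<gamma> t = 0"
  have "((\<lambda>t. sgn (velocity \<gamma> t)) has_vector_derivative 0) (at t within cdomain \<gamma>)" if "t \<in> cdomain \<gamma>" for t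
    using sgn_velocity_has_derivative[OF \<gamma> that] zero that by simp
  then obtain T where T: "\<And>t. t \<in> cdomain \<gamma> \<Longrightarrow> sgn (velocity \<gamma> t) = T"
    using has_vector_derivative_zero_constant[OF convex_cdomain[OF \<gamma>]] by blast
  have "((\<lambda>t. cmap \<gamma> t - arclength \<gamma> t *\<^sub>R T) has_vector_derivative 0) (at t within cdomain \<gamma>)"
    if t: "t \<in> cdomain \<gamma>" for t
  proof -
    have "((\<lambda>t. arclength \<gamma> t *\<^sub>R T) has_vector_derivative norm (velocity \<gamma> t) *\<^sub>R T) (at t within cdomain \<gamma>)"
      using has_vector_derivative_scaleR[OF has_real_derivative_arclength[OF \<gamma> t] has_vector_derivative_const]
      by simp
    moreover have "norm (velocity \<gamma> t) *\<^sub>R T = velocity \<gamma> t"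
      using T[OF t, symmetric] velocity_nonzero[OF \<gamma> t] by (simp add: sgn_div_norm)
    ultimately show ?thesis
      using has_vector_derivative_diff[OF smooth_on_velocity(2)[OF \<gamma> t]] by fastforce
  qed
  then obtain p where p: "\<And>t. t \<in> cdomain \<gamma> \<Longrightarrow> cmap \<gamma> t - arclength \<gamma> t *\<^sub>R T = p"
    using has_vector_derivative_zero_constant[OF convex_cdomain[OF \<gamma>]] by blast
  have "T \<noteq> 0"
    using T[OF cbase_in_cdomain[OF \<gamma>]] velocity_nonzero[OF \<gamma> cbase_in_cdomain[OF \<gamma>]] by (auto simp: sgn_zero_iff)
  have "cmap \<gamma> t \<in> affine hull {p, p + T}" if t: "t \<in> cdomain \<gamma>" for t
  proof -
    have "cmap \<gamma> t = (1 - arclength \<gamma> t) *\<^sub>R p + arclength \<gamma> t *\<^sub>R (p + T)"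
      using p[OF t] by (simp add: algebra_simps)
    then show ?thesis
      unfolding affine_hull_2
      by (intro CollectI exI[of _ "1 - arclength \<gamma> t"] exI[of _ "arclength \<gamma> t"]) simp
  qed
  then show "is_line \<gamma>"
    unfolding is_line_def using \<open>T \<noteq> 0\<close>
    by (intro exI[of _ "affine hull {p, p + T}"]) (auto simp: aff_dim_2)
qed

text \<open>On a circle about c the velocity is \<open>l * \<i> * (\<gamma> - c)\<close> with
  angular speed l, and the curvature is \<open>sgn l / r\<close>. Conversely, for constant curvature
  k the centre of curvature \<open>\<gamma> + (\<i> / k) * T\<close> does not move.\<close>

lemma is_circle_iff_curvature:
  assumes \<gamma>: "is_curve \<gamma>"
  shows "is_circle \<gamma> \<longleftrightarrow> (\<exists>k. k \<noteq> 0 \<and> (\<forall>t\<in>cdomain \<gamma>. curvature \<gamma> t = k))"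
proof
  assume "is_circle \<gamma>"
  then obtain c r where r: "r > 0" and sph: "\<And>t. t \<in> cdomain \<gamma> \<Longrightarrow> dist c (cmap \<gamma> t) = r"
    unfolding is_circle_def by (force simp: sphere_def)
  define x where "x = (\<lambda>t. Re (cmap \<gamma> t - c))"
  define y where "y = (\<lambda>t. Im (cmap \<gamma> t - c))"
  define v where "v = velocity \<gamma>"
  define a where "a = acceleration \<gamma>"
  have dx: "(x has_real_derivative Re (v t)) (at t within cdomain \<gamma>)"
    and dy: "(y has_real_derivative Im (v t)) (at t within cdomain \<gamma>)"
    and dv: "((\<lambda>t. Re (v t)) has_real_derivative Re (a t)) (at t within cdomain \<gamma>)"
      "((\<lambda>t. Im (v t)) has_real_derivative Im (a t)) (at t within cdomain \<gamma>)"
    if "t \<in> cdomain \<gamma>" for t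
    using smooth_on_velocity(2)[OF \<gamma> that] has_vector_derivative_velocity[OF \<gamma> that]
    unfolding x_def y_def v_def a_def
    by (auto intro!: derivative_eq_intros has_real_derivative_Re_Im)
  have 0: "x t * x t + y t * y t = r\<^sup>2" if "t \<in> cdomain \<gamma>" for t
  proof -
    have "norm (cmap \<gamma> t - c) = r" using sph[OF that] by (simp add: dist_norm norm_minus_commute)
    then show ?thesis
      using cmod_power2[of "cmap \<gamma> t - c"] by (simp add: x_def y_def power2_eq_square)
  qed
  have 1: "x t * Re (v t) + y t * Im (v t) = 0" if t: "t \<in> cdomain \<gamma>" for t
  proof -
    have "2 * (x t * Re (v t) + y t * Im (v t)) = 0"
      by (rule derivative_constant_on_curve[OF \<gamma> t 0])
        (auto intro!: derivative_eq_intros dx[OF t] dy[OF t] simp: algebra_simps)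
    then show ?thesis by simp
  qed
  have 2: "Re (v t) * Re (v t) + x t * Re (a t) + (Im (v t) * Im (v t) + y t * Im (a t)) = 0"
    if t: "t \<in> cdomain \<gamma>" for t
    by (rule derivative_constant_on_curve[OF \<gamma> t 1])
      (auto intro!: derivative_eq_intros dx[OF t] dy[OF t]
        has_vector_derivative_velocity[OF \<gamma> t, folded v_def a_def] simp: algebra_simps)
  \<comment> \<open>The angular speed about c. It is continuous and never zero, so its sign is
    constant and the curvature cannot jump between 1 / r and -1 / r.\<close>
  define l where "l = (\<lambda>t. (x t * Im (v t) - y t * Re (v t)) / r\<^sup>2)"
  have l: "Re (v t) = - l t * y t" "Im (v t) = l t * x t" if t: "t \<in> cdomain \<gamma>" for t
  proof -
    have "Re (v t) * r\<^sup>2 = - (x t * Im (v t) - y t * Re (v t)) * y t"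
      "Im (v t) * r\<^sup>2 = (x t * Im (v t) - y t * Re (v t)) * x t"
      using 0[OF t] 1[OF t] by algebra+
    then show "Re (v t) = - l t * y t" "Im (v t) = l t * x t"
      using r by (simp_all add: l_def field_simps)
  qed
  have nv: "norm (v t) = \<bar>l t\<bar> * r" if t: "t \<in> cdomain \<gamma>" for t
  proof -
    have "(norm (v t))\<^sup>2 = (l t)\<^sup>2 * (x t * x t + y t * y t)"
      unfolding cmod_power2 l[OF t] by (simp add: power2_eq_square algebra_simps)
    then have "(norm (v t))\<^sup>2 = (\<bar>l t\<bar> * r)\<^sup>2" unfolding 0[OF t] by (simp add: power_mult_distrib)
    then show ?thesis using r by (simp add: power2_eq_iff_nonneg)
  qed
  have lnz: "l t \<noteq> 0" if t: "t \<in> cdomain \<gamma>" for t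
    using nv[OF t] velocity_nonzero[OF \<gamma> t] by (auto simp: v_def)
  have "continuous_on (cdomain \<gamma>) x" "continuous_on (cdomain \<gamma>) y"
    "continuous_on (cdomain \<gamma>) (\<lambda>t. Re (v t))" "continuous_on (cdomain \<gamma>) (\<lambda>t. Im (v t))"
    by (rule DERIV_continuous_on, erule dx dy dv)+
  then have "continuous_on (cdomain \<gamma>) l"
    unfolding l_def using r by (auto intro!: continuous_intros)
  moreover have "connected (cdomain \<gamma>)" "cdomain \<gamma> \<noteq> {}"
    using \<gamma> by (auto simp: is_curve_def is_interval_connected_1)
  ultimately obtain \<sigma> where \<sigma>: "\<sigma> \<in> {1, -1}" "\<And>t. t \<in> cdomain \<gamma> \<Longrightarrow> sgn (l t) = \<sigma>"
    using sgn_const_on lnz by metis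
  have "curvature \<gamma> t = \<sigma> / r" if t: "t \<in> cdomain \<gamma>" for t
  proof -
    have "(norm (v t))\<^sup>2 = Re (v t) * Re (v t) + Im (v t) * Im (v t)"
      using cmod_power2[of "v t"] by (simp only: power2_eq_square)
    \<comment> \<open>By \<open>l\<close>, the left side is -l times the inner product of position
      and acceleration, which by the twice differentiated circle equation is minus the squared
      speed.\<close>
    then have "Re (v t) * Im (a t) - Im (v t) * Re (a t) = l t * (norm (v t))\<^sup>2"
      using 2[OF t] l[OF t] by algebra
    then have "curvature \<gamma> t * norm (v t) ^ 3 = l t * (norm (v t))\<^sup>2"
      using curvature_Re_Im[OF \<gamma> t] by (simp add: v_def a_def)
    then have "curvature \<gamma> t * norm (v t) = l t"
      using velocity_nonzero[OF \<gamma> t] by (simp add: v_def power3_eq_cube power2_eq_square)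
    moreover have "\<bar>l t\<bar> = l t * \<sigma>" using \<sigma>(2)[OF t] by (simp add: abs_sgn)
    ultimately have "l t * (curvature \<gamma> t * \<sigma> * r) = l t * 1" by (simp add: nv[OF t] mult_ac)
    then have "curvature \<gamma> t * \<sigma> * r = 1" using lnz[OF t] using mult_left_cancel by blast
    then show ?thesis using r \<sigma>(1) by (auto simp: field_simps)
  qed
  then show "\<exists>k. k \<noteq> 0 \<and> (\<forall>t\<in>cdomain \<gamma>. curvature \<gamma> t = k)"
    using \<sigma>(1) r by (intro exI[of _ "\<sigma> / r"]) auto
next
  assume "\<exists>k. k \<noteq> 0 \<and> (\<forall>t\<in>cdomain \<gamma>. curvature \<gamma> t = k)"
  then obtain k where k: "k \<noteq> 0" "\<And>t. t \<in> cdomain \<gamma> \<Longrightarrow> curvature \<gamma> t = k" by blast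
  have "((\<lambda>t. cmap \<gamma> t + (\<i> / k) * sgn (velocity \<gamma> t)) has_vector_derivative 0) (at t within cdomain \<gamma>)"
    if t: "t \<in> cdomain \<gamma>" for t
    using has_vector_derivative_add[OF smooth_on_velocity(2)[OF \<gamma> t]
        has_vector_derivative_mult_right[OF sgn_velocity_has_derivative[OF \<gamma> t], of "\<i> / k"]] k(1) k(2)[OF t]
    by (simp add: field_simps)
  then obtain c where c: "\<And>t. t \<in> cdomain \<gamma> \<Longrightarrow> cmap \<gamma> t + (\<i> / k) * sgn (velocity \<gamma> t) = c"
    using has_vector_derivative_zero_constant[OF convex_cdomain[OF \<gamma>]] by blast
  have "dist c (cmap \<gamma> t) = 1 / \<bar>k\<bar>" if t: "t \<in> cdomain \<gamma>" for t
    using c[OF t, symmetric] velocity_nonzero[OF \<gamma> t]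
    by (simp add: dist_norm norm_mult norm_divide norm_sgn)
  then show "is_circle \<gamma>"
    unfolding is_circle_def using k(1) by (intro exI[of _ c] exI[of _ "1 / \<bar>k\<bar>"]) auto
qed

section \<open>The normal form of the curvature\<close>

text \<open>The integral of 1 / (1 + \<beta> u) from 0 to s; the case \<beta> = 0 is the limit of
  the other.\<close>

definition lac_time :: "real \<Rightarrow> real \<Rightarrow> real" where
  "lac_time \<beta> s = (if \<beta> = 0 then s else ln (1 + \<beta> * s) / \<beta>)"

text \<open>The solution of \<open>S' = 1 + \<beta> * S\<close> with \<open>S 0 = 0\<close>, inverse
  to \<open>lac_time\<close>.\<close>

definition lac_length :: "real \<Rightarrow> real \<Rightarrow> real" where
  "lac_length \<beta> t = (if \<beta> = 0 then t else (exp (\<beta> * t) - 1) / \<beta>)"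

lemma lac_length_time: "1 + \<beta> * s > 0 \<Longrightarrow> lac_length \<beta> (lac_time \<beta> s) = s"
  by (simp add: lac_length_def lac_time_def)

text \<open>This is the self-affinity of the arc length when the base point has parameter 0:
  re-basing at t amounts to scaling by \<open>exp (\<beta> * t)\<close>.\<close>

lemma lac_length_add: "lac_length \<beta> (s + t) - lac_length \<beta> t = exp (\<beta> * t) * lac_length \<beta> s"
  by (simp add: lac_length_def field_simps exp_add)

lemma one_plus_lac_length: "1 + \<beta> * lac_length \<beta> t = exp (\<beta> * t)"
  by (simp add: lac_length_def)

lemma lac_time_has_derivative:
  assumes "1 + \<beta> * s > 0"
  shows "(lac_time \<beta> has_real_derivative inverse (1 + \<beta> * s)) (at s within S)"
proof (cases "\<beta> = 0")
  case True
  then show ?thesis by (simp add: lac_time_def[abs_def])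
next
  case False
  have "((\<lambda>s. ln (1 + \<beta> * s) / \<beta>) has_real_derivative inverse (1 + \<beta> * s)) (at s within S)"
    using assms False by (auto intro!: derivative_eq_intros simp: inverse_eq_divide)
  then show ?thesis using False by (simp add: lac_time_def[abs_def])
qed

lemma lac_length_has_derivative:
  "(lac_length \<beta> has_real_derivative exp (\<beta> * t)) (at t within S)"
proof (cases "\<beta> = 0")
  case True
  then show ?thesis by (simp add: lac_length_def[abs_def])
next
  case False
  have "((\<lambda>t. (exp (\<beta> * t) - 1) / \<beta>) has_real_derivative exp (\<beta> * t)) (at t within S)"
    using False by (auto intro!: derivative_eq_intros)
  then show ?thesis using False by (simp add: lac_length_def[abs_def])
qed

text \<open>A common normal form: lines are \<open>k = 0\<close>, circles are \<open>d = 0\<close>, log-aesthetic curves of slope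
  \<open>0\<close> are \<open>\<beta> = 0\<close> and those of slope \<open>\<alpha> \<noteq> 0\<close> have \<open>\<alpha> = \<beta> / d\<close>.\<close>

definition exponential_curvature :: "pcurve \<Rightarrow> bool" where
  "exponential_curvature \<gamma> \<longleftrightarrow> (\<exists>\<beta> d k. \<forall>t\<in>cdomain \<gamma>.
     1 + \<beta> * arclength \<gamma> t > 0 \<and> curvature \<gamma> t = k * exp (- d * lac_time \<beta> (arclength \<gamma> t)))"

text \<open>The normal form is the LAC equation with \<xi> s + \<eta> scaled to the value 1 at the
  base point when \<alpha> \<noteq> 0; the scale is moved into k, whose sign becomes the orientation
  of the congruence.\<close>

lemma exponential_curvature_iff:
  assumes \<gamma>: "is_curve \<gamma>"
  shows "exponential_curvature \<gamma> \<longleftrightarrow> is_circle \<gamma> \<or> is_line \<gamma> \<or> is_LAC \<gamma>"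
proof
  assume "exponential_curvature \<gamma>"
  then obtain \<beta> d k where pos: "\<And>t. t \<in> cdomain \<gamma> \<Longrightarrow> 1 + \<beta> * arclength \<gamma> t > 0"
    and \<kappa>: "\<And>t. t \<in> cdomain \<gamma> \<Longrightarrow> curvature \<gamma> t = k * exp (- d * lac_time \<beta> (arclength \<gamma> t))"
    unfolding exponential_curvature_def by blast
  consider "k = 0" | "k \<noteq> 0" "d = 0" | "k \<noteq> 0" "d \<noteq> 0" by blast
  then show "is_circle \<gamma> \<or> is_line \<gamma> \<or> is_LAC \<gamma>"
  proof cases
    case 1
    then show ?thesis using \<kappa> is_line_iff_curvature[OF \<gamma>] by simp
  next
    case 2
    then have "\<forall>t\<in>cdomain \<gamma>. curvature \<gamma> t = k" using \<kappa> by simp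
    then show ?thesis using 2(1) is_circle_iff_curvature[OF \<gamma>] by blast
  next
    case 3
    define c where "c = ln \<bar>k\<bar>"
    have \<kappa>': "sgn k * curvature \<gamma> t = exp (c - d * lac_time \<beta> (arclength \<gamma> t))" if "t \<in> cdomain \<gamma>" for t
    proof -
      have "exp c = sgn k * k" using 3 by (simp add: c_def sgn_mult_self_eq abs_if sgn_real_def)
      then show ?thesis by (simp add: \<kappa>[OF that] exp_diff exp_minus divide_inverse)
    qed
    have "is_LAC \<gamma>"
    proof (cases "\<beta> = 0")
      case True
      show ?thesis
        unfolding is_LAC_iff[OF \<gamma>]
        by (rule bexI[of _ "sgn k"], rule exI[of _ 0], rule exI[of _ d], rule exI[of _ "- c"])
          (use 3 True \<kappa>' in \<open>auto simp: lac_time_def sgn_real_def\<close>)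
    next
      case False
      \<comment> \<open>The factor to be put on \<open>1 + \<beta> * s\<close> so that its power
        with exponent -1 / \<alpha> = -d / \<beta> contributes exactly \<open>exp c\<close>, the
        absolute value of k.\<close>
      define E where "E = exp (- c * \<beta> / d)"
      have E: "E > 0" by (simp add: E_def)
      have eq: "\<beta> * E * arclength \<gamma> t + E = (1 + \<beta> * arclength \<gamma> t) * E" for t
        by (simp add: algebra_simps)
      have "ln ((1 + \<beta> * arclength \<gamma> t) * E) / (\<beta> / d) = - (c - d * lac_time \<beta> (arclength \<gamma> t))"
        if "t \<in> cdomain \<gamma>" for t
      proof -
        have "ln ((1 + \<beta> * arclength \<gamma> t) * E) = ln (1 + \<beta> * arclength \<gamma> t) - c * \<beta> / d"
          using pos[OF that] E by (simp add: ln_mult) (simp add: E_def)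
        then show ?thesis using 3 False by (simp add: lac_time_def field_simps)
      qed
      then have "\<forall>t\<in>cdomain \<gamma>. (\<beta> / d \<noteq> 0 \<longrightarrow> \<beta> * E * arclength \<gamma> t + E > 0) \<and>
          sgn k * curvature \<gamma> t = exp (- (if \<beta> / d = 0 then \<beta> * E * arclength \<gamma> t + E
            else ln (\<beta> * E * arclength \<gamma> t + E) / (\<beta> / d)))"
        unfolding eq using 3 False E \<kappa>' pos by simp
      moreover have "sgn k \<in> {1, -1}" "\<beta> * E \<noteq> 0" using 3 False E by (auto simp: sgn_real_def)
      ultimately show ?thesis
        unfolding is_LAC_iff[OF \<gamma>] by blast
    qed
    then show ?thesis by blast
  qed
next
  assume "is_circle \<gamma> \<or> is_line \<gamma> \<or> is_LAC \<gamma>"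
  then consider "is_circle \<gamma>" | "is_line \<gamma>" | "is_LAC \<gamma>" by blast
  then show "exponential_curvature \<gamma>"
  proof cases
    case 1
    then obtain k where "\<And>t. t \<in> cdomain \<gamma> \<Longrightarrow> curvature \<gamma> t = k"
      using is_circle_iff_curvature[OF \<gamma>] by blast
    then show ?thesis
      unfolding exponential_curvature_def by (intro exI[of _ 0] exI[of _ k]) simp
  next
    case 2
    then show ?thesis
      using is_line_iff_curvature[OF \<gamma>] unfolding exponential_curvature_def
      by (intro exI[of _ 0]) simp
  next
    case 3
    then obtain \<sigma> \<alpha> \<xi> \<eta> where \<sigma>: "\<sigma> \<in> {1, -1}" and "\<xi> \<noteq> 0"
      and pos: "\<And>t. t \<in> cdomain \<gamma> \<Longrightarrow> \<alpha> \<noteq> 0 \<Longrightarrow> \<xi> * arclength \<gamma> t + \<eta> > 0"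
      and eq: "\<And>t. t \<in> cdomain \<gamma> \<Longrightarrow> \<sigma> * curvature \<gamma> t =
        exp (- (if \<alpha> = 0 then \<xi> * arclength \<gamma> t + \<eta> else ln (\<xi> * arclength \<gamma> t + \<eta>) / \<alpha>))"
      unfolding is_LAC_iff[OF \<gamma>] by blast
    have \<kappa>: "curvature \<gamma> t =
        \<sigma> * exp (- (if \<alpha> = 0 then \<xi> * arclength \<gamma> t + \<eta> else ln (\<xi> * arclength \<gamma> t + \<eta>) / \<alpha>))"
      if "t \<in> cdomain \<gamma>" for t
      unfolding eq[OF that, symmetric] using \<sigma> by auto
    show ?thesis
    proof (cases "\<alpha> = 0")
      case True
      then show ?thesis
        unfolding exponential_curvature_def using \<kappa>
        by (intro exI[of _ 0] exI[of _ \<xi>] exI[of _ "\<sigma> * exp (- \<eta>)"])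
          (simp add: lac_time_def exp_diff exp_minus field_simps)
    next
      case False
      \<comment> \<open>Positivity at the base point, where s = 0; this permits dividing by
        \<eta>.\<close>
      have \<eta>: "\<eta> > 0" using pos[OF cbase_in_cdomain[OF \<gamma>] False] by simp
      have factor: "\<xi> * arclength \<gamma> t + \<eta> = \<eta> * (1 + \<xi> / \<eta> * arclength \<gamma> t)" for t
        using \<eta> by (simp add: field_simps)
      have p: "1 + \<xi> / \<eta> * arclength \<gamma> t > 0" if "t \<in> cdomain \<gamma>" for t
        using pos[OF that False] \<eta> unfolding factor by (simp add: zero_less_mult_iff)
      have "curvature \<gamma> t = \<sigma> * exp (- ln \<eta> / \<alpha>) * exp (- (\<xi> / \<eta> / \<alpha>) * lac_time (\<xi> / \<eta>) (arclength \<gamma> t))"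
        if t: "t \<in> cdomain \<gamma>" for t
      proof -
        have "ln (\<xi> * arclength \<gamma> t + \<eta>) = ln \<eta> + ln (1 + \<xi> / \<eta> * arclength \<gamma> t)"
          unfolding factor by (rule ln_mult_pos[OF \<eta> p[OF t]])
        moreover have "(\<xi> / \<eta>) * lac_time (\<xi> / \<eta>) (arclength \<gamma> t) = ln (1 + \<xi> / \<eta> * arclength \<gamma> t)"
          using \<open>\<xi> \<noteq> 0\<close> \<eta> by (simp add: lac_time_def)
        ultimately have "- (ln (\<xi> * arclength \<gamma> t + \<eta>) / \<alpha>) =
            - ln \<eta> / \<alpha> + - (\<xi> / \<eta> / \<alpha>) * lac_time (\<xi> / \<eta>) (arclength \<gamma> t)"
          using False by (simp add: field_simps)
        then show ?thesis
          unfolding \<kappa>[OF t] using False by (simp only: exp_add if_False mult.assoc)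
      qed
      then show ?thesis
        unfolding exponential_curvature_def using p by blast
    qed
  qed
qed

subsection \<open>Miura self-affinity\<close>

lemma interval_mvt:
  fixes f :: "real \<Rightarrow> real"
  assumes I: "is_interval I" and f: "\<And>x. x \<in> I \<Longrightarrow> (f has_real_derivative f' x) (at x within I)"
    and "a \<in> I" "b \<in> I"
  obtains x where "x \<in> I" "f b - f a = f' x * (b - a)"
proof -
  have *: "\<exists>x\<in>I. f b - f a = f' x * (b - a)" if "a \<in> I" "b \<in> I" "a < b" for a b
  proof -
    have sub: "{a..b} \<subseteq> I"
      using I that(1,2) unfolding is_interval_1 by (meson atLeastAtMost_iff subsetI)
    have "\<exists>x\<in>{a<..<b}. f b - f a = (\<lambda>h. f' x * h) (b - a)"
    proof (rule mvt_simple[OF \<open>a < b\<close>])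
      fix x assume "a \<le> x" "x \<le> b"
      then show "(f has_derivative (\<lambda>h. f' x * h)) (at x within {a..b})"
        using has_derivative_subset[OF _ sub] f sub unfolding has_field_derivative_def
        by (metis atLeastAtMost_iff subsetD)
    qed
    then show ?thesis using sub by force
  qed
  consider "a < b" | "b < a" | "a = b" by linarith
  then show thesis
  proof cases
    case 1
    then show thesis using *[of a b] assms that by blast
  next
    case 2
    then obtain x where "x \<in> I" "f a - f b = f' x * (a - b)" using *[of b a] assms by blast
    then show thesis using that[of x] by (simp add: algebra_simps)
  next
    case 3
    then show thesis using that[of a] assms by simp
  qed
qed

text \<open>By the mean value theorem a nonvanishing derivative makes \<open>t\<close> injective.
  The inverse \<phi> has derivative 1 / q(\<phi>), also one-sidedly at endpoints, so the composition
  of \<gamma> with \<phi> is again a smooth curve.\<close>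

lemma reparametrization_exists:
  assumes \<gamma>: "is_curve \<gamma>" and q: "smooth_on (cdomain \<gamma>) q" "\<And>u. u \<in> cdomain \<gamma> \<Longrightarrow> q u \<noteq> 0"
    and t: "\<And>u. u \<in> cdomain \<gamma> \<Longrightarrow> (t has_real_derivative q u) (at u within cdomain \<gamma>)"
  obtains \<gamma>' where "is_curve \<gamma>'" "reparametrization \<gamma> \<gamma>' t"
    "cdomain \<gamma>' = t ` cdomain \<gamma>" "cbase \<gamma>' = t (cbase \<gamma>)"
proof -
  define I where "I = cdomain \<gamma>"
  have ivl: "is_interval I" using \<gamma> by (simp add: I_def is_curve_def)
  have ts: "smooth_on I t"
    using smooth_on_antideriv[OF q(1), of t] t by (simp add: I_def has_real_derivative_iff_has_vector_derivative)
  have inj: "inj_on t I"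
  proof (rule inj_onI)
    fix a b assume ab: "a \<in> I" "b \<in> I" "t a = t b"
    from interval_mvt[OF ivl t[folded I_def] ab(1,2)] obtain x where "x \<in> I" "t b - t a = q x * (b - a)"
      by blast
    then show "a = b" using ab(3) q(2)[of x] by (simp add: I_def)
  qed
  have "path_connected I" using ivl by (simp add: is_interval_convex_1 convex_imp_path_connected)
  then obtain \<phi> where hom: "homeomorphism I (t ` I) t \<phi>"
    using homeomorphism_into_1d[OF _ smooth_on_continuous_on[OF ts] refl inj] by blast
  then have \<phi>t: "\<And>u. u \<in> I \<Longrightarrow> \<phi> (t u) = u" and cont: "continuous_on (t ` I) \<phi>"
    by (auto simp: homeomorphism_def)
  have d\<phi>: "(\<phi> has_real_derivative inverse (q (\<phi> x))) (at x within t ` I)" if x: "x \<in> t ` I" for x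
  proof -
    obtain u where u: "u \<in> I" "x = t u" using x by blast
    have "(\<phi> has_derivative (*) (inverse (q u))) (at (t u) within t ` I)"
    proof (rule has_derivative_inverse_within)
      show "(t has_derivative (*) (q u)) (at u within I)"
        using t u(1) by (simp add: I_def has_field_derivative_def)
      show "continuous (at (t u) within t ` I) \<phi>"
        using cont u(1) by (simp add: continuous_on_eq_continuous_within)
      show "linear ((*) (inverse (q u)))" by (simp add: linear_times)
      show "(*) (inverse (q u)) \<circ> (*) (q u) = id"
        using q(2) u(1) by (auto simp: I_def fun_eq_iff)
    qed (use u \<phi>t in auto)
    then show ?thesis using u \<phi>t by (simp add: has_field_derivative_def)
  qed
  define \<gamma>' where "\<gamma>' = \<lparr>cdomain = t ` I, cmap = cmap \<gamma> \<circ> \<phi>, cbase = t (cbase \<gamma>)\<rparr>"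
  have simps [simp]: "cdomain \<gamma>' = t ` I" "cmap \<gamma>' = (\<lambda>x. cmap \<gamma> (\<phi> x))" "cbase \<gamma>' = t (cbase \<gamma>)"
    by (simp_all add: \<gamma>'_def o_def)
  have ivlJ: "is_interval (t ` I)"
    using connected_continuous_image[OF smooth_on_continuous_on[OF ts]] ivl
    by (simp add: is_interval_connected_1)
  obtain a b where ab: "a \<in> I" "b \<in> I" "a < b" using \<gamma> by (auto simp: is_curve_def I_def)
  then have "t a \<noteq> t b" using inj by (auto simp: inj_on_def)
  then have ex: "\<exists>x\<in>t ` I. \<exists>y\<in>t ` I. x < y"
    using ab(1,2) by (cases "t a < t b") force+
  have "at x within t ` I \<noteq> bot" if "x \<in> t ` I" for x
    using interval_at_within_neq_bot[OF ivlJ ex that] .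
  moreover have "(cmap \<gamma>' has_vector_derivative inverse (q (\<phi> x)) *\<^sub>R velocity \<gamma> (\<phi> x)) (at x within t ` I)"
    if x: "x \<in> t ` I" for x
  proof -
    have "\<phi> ` t ` I = I" using \<phi>t by (force simp: image_image)
    moreover have "\<phi> x \<in> I" using x \<phi>t by auto
    ultimately have "((cmap \<gamma> \<circ> \<phi>) has_vector_derivative inverse (q (\<phi> x)) *\<^sub>R velocity \<gamma> (\<phi> x)) (at x within t ` I)"
      using d\<phi>[OF x] smooth_on_velocity(2)[OF \<gamma>, of "\<phi> x"]
      by (intro vector_diff_chain_within) (simp_all add: I_def has_real_derivative_iff_has_vector_derivative)
    then show ?thesis by (simp add: o_def)
  qed
  ultimately have "velocity \<gamma>' x = inverse (q (\<phi> x)) *\<^sub>R velocity \<gamma> (\<phi> x)" if "x \<in> t ` I" for x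
    unfolding velocity_def[of \<gamma>'] using that by (auto intro: vector_derivative_within)
  then have nz: "velocity \<gamma>' x \<noteq> 0" if "x \<in> t ` I" for x
    using that velocity_nonzero[OF \<gamma>] q(2) \<phi>t by (auto simp: I_def)
  have "smooth_on (t ` I) (cmap \<gamma>')"
    unfolding simps
  proof (rule smooth_on_compose_inverse)
    show "smooth_on I (cmap \<gamma>)" using \<gamma> by (simp add: is_curve_def I_def)
    show "smooth_on I q" using q(1) by (simp add: I_def)
    show "q u \<noteq> 0" if "u \<in> I" for u using q(2) that by (simp add: I_def)
    show "\<phi> x \<in> I" if "x \<in> t ` I" for x using \<phi>t that by auto
  qed (rule d\<phi>)
  then have "is_curve \<gamma>'"
    unfolding is_curve_def using ivlJ ex nz cbase_in_cdomain[OF \<gamma>] by (simp add: I_def)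
  moreover have "reparametrization \<gamma> \<gamma>' t"
    unfolding reparametrization_def using ts hom \<phi>t by (auto simp: I_def[symmetric])
  ultimately show thesis using that by (simp add: I_def)
qed

text \<open>In the parameter \<open>lac_time \<beta> s\<close> the arc length is
  \<open>lac_length \<beta>\<close> and the curvature is an exponential, and translating the
  parameter scales both.\<close>

lemma exponential_curvature_imp_MSA:
  assumes \<gamma>: "is_curve \<gamma>" and "exponential_curvature \<gamma>"
  shows "MSA \<gamma>"
proof -
  define I where "I = cdomain \<gamma>"
  define s where "s = arclength \<gamma>"
  define b where "b = cbase \<gamma>"
  obtain \<beta> d k where pos: "\<And>u. u \<in> I \<Longrightarrow> 1 + \<beta> * s u > 0"
    and \<kappa>: "\<And>u. u \<in> I \<Longrightarrow> curvature \<gamma> u = k * exp (- d * lac_time \<beta> (s u))"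
    using assms(2) unfolding exponential_curvature_def I_def s_def by blast
  have ivl: "is_interval I" and bI: "b \<in> I" using \<gamma> by (auto simp: I_def b_def is_curve_def)
  obtain y where y: "y \<in> I" "y \<noteq> b"
    using \<gamma> unfolding I_def is_curve_def by (metis less_irrefl)
  \<comment> \<open>The orientation is chosen so that the base point is not the last point of the new interval;
    otherwise no shift would be a curve.\<close>
  define \<theta> where "\<theta> = sgn (y - b)"
  have \<theta>: "\<theta> * \<theta> = 1" "\<theta> * (y - b) > 0" using y(2) by (auto simp: \<theta>_def sgn_real_def)
  define t where "t = (\<lambda>u. \<theta> * lac_time \<beta> (s u))"
  define q where "q = (\<lambda>u. \<theta> * (norm (velocity \<gamma> u) * inverse (1 + \<beta> * s u)))"
  have q: "smooth_on I q"
    unfolding q_def s_def I_def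
    by (intro smooth_on_mult smooth_on_const smooth_on_inverse smooth_on_add smooth_on_speed
        smooth_on_arclength \<gamma>) (use pos in \<open>force simp: I_def s_def\<close>)
  have t: "(t has_real_derivative q u) (at u within I)" if u: "u \<in> I" for u
  proof -
    have "((\<lambda>u. lac_time \<beta> (s u)) has_real_derivative inverse (1 + \<beta> * s u) * norm (velocity \<gamma> u)) (at u within I)"
      using DERIV_chain'[OF has_real_derivative_arclength[OF \<gamma>] lac_time_has_derivative] u pos[OF u]
      by (simp add: I_def s_def mult.commute)
    from DERIV_cmult[OF this, of \<theta>] show ?thesis by (simp add: t_def q_def mult_ac)
  qed
  have qnz: "q u \<noteq> 0" if "u \<in> I" for u
    using pos[OF that] velocity_nonzero[OF \<gamma>] that \<theta>(1) by (auto simp: q_def I_def)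
  obtain \<gamma>' where \<gamma>': "is_curve \<gamma>'" and rep: "reparametrization \<gamma> \<gamma>' t"
    and dom: "cdomain \<gamma>' = t ` I" and base: "cbase \<gamma>' = t b"
    using reparametrization_exists[OF \<gamma> q[unfolded I_def] qnz[unfolded I_def] t[unfolded I_def]]
    by (auto simp: I_def b_def)
  have tb: "t b = 0" by (simp add: t_def s_def b_def lac_time_def)
  \<comment> \<open>The aim is \<open>t y > 0 = t b\<close>, so that the shift by \<open>t y\<close>
    moves the base point to another point of the new interval.\<close>
  obtain x where x: "x \<in> I" "t y - t b = q x * (y - b)" using interval_mvt[OF ivl t bI y(1)] by blast
  have "q x * (y - b) = \<theta> * (y - b) * (norm (velocity \<gamma> x) * inverse (1 + \<beta> * s x))"
    by (simp add: q_def)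
  also have "\<dots> > 0"
    using \<theta>(2) pos[OF x(1)] velocity_nonzero[OF \<gamma>] x(1) by (auto simp: I_def)
  finally have "t y > 0" using x(2) tb by simp
  then have ex: "\<exists>\<epsilon>>0. is_curve (shift \<epsilon> \<gamma>')"
    unfolding is_curve_shift_iff[OF \<gamma>'] base tb dom using y(1) by auto
  obtain \<sigma> :: real where \<sigma>: "\<sigma> \<in> {1, -1}"
    and s': "\<And>u. u \<in> I \<Longrightarrow> s u = \<sigma> * arclength \<gamma>' (t u)"
    and \<kappa>': "\<And>u. u \<in> I \<Longrightarrow> curvature \<gamma> u = \<sigma> * curvature \<gamma>' (t u)"
    using reparametrization_invariants[OF \<gamma> \<gamma>' rep] unfolding I_def s_def by metis
  \<comment> \<open>The sign \<sigma> can stay unspecified: it is a common factor of both sides of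
    either affinity relation.\<close>
  have S: "arclength \<gamma>' \<tau> = \<sigma> * lac_length \<beta> (\<theta> * \<tau>)"
    and K: "curvature \<gamma>' \<tau> = \<sigma> * k * exp (- d * \<theta> * \<tau>)" if \<tau>: "\<tau> \<in> cdomain \<gamma>'" for \<tau>
  proof -
    obtain u where u: "u \<in> I" "\<tau> = t u" using \<tau> unfolding dom by blast
    have L: "\<theta> * \<tau> = lac_time \<beta> (s u)" by (simp only: u(2) t_def mult.assoc[symmetric] \<theta>(1) mult_1)
    show "arclength \<gamma>' \<tau> = \<sigma> * lac_length \<beta> (\<theta> * \<tau>)"
      unfolding L lac_length_time[OF pos[OF u(1)]] using s'[OF u(1)] \<sigma> u(2) by auto
    show "curvature \<gamma>' \<tau> = \<sigma> * k * exp (- d * \<theta> * \<tau>)"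
    proof -
      have "curvature \<gamma>' \<tau> = \<sigma> * curvature \<gamma> u" using \<kappa>'[OF u(1)] \<sigma> u(2) by auto
      also have "\<dots> = \<sigma> * k * exp (- d * (\<theta> * \<tau>))" unfolding L \<kappa>[OF u(1)] by simp
      finally show ?thesis by (simp only: mult.assoc)
    qed
  qed
  \<comment> \<open>Read off from \<open>S\<close> and \<open>K\<close>: replacing \<tau> by \<tau>
    + \<epsilon> adds \<theta> \<epsilon> to the argument, which scales the arc length by
    \<open>exp (\<beta> * \<theta> * \<epsilon>)\<close> and the radius by
    \<open>exp (d * \<theta> * \<epsilon>)\<close>.\<close>
  define \<mu> \<nu> where "\<mu> = exp (\<beta> * \<theta>)" and "\<nu> = exp (d * \<theta>)"
  have "arclength (shift \<epsilon> \<gamma>') \<tau> = \<mu> powr \<epsilon> * arclength \<gamma>' \<tau> \<and>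
      curvature_radius (shift \<epsilon> \<gamma>') \<tau> = ereal (\<nu> powr \<epsilon>) * curvature_radius \<gamma>' \<tau>"
    if "is_curve (shift \<epsilon> \<gamma>')" and \<tau>: "\<tau> \<in> cdomain \<gamma>'" "\<tau> \<in> cdomain (shift \<epsilon> \<gamma>')" for \<epsilon> \<tau>
  proof -
    have \<epsilon>: "cbase \<gamma>' + \<epsilon> \<in> cdomain \<gamma>'" using that(1) is_curve_shift_iff[OF \<gamma>'] by blast
    have \<tau>\<epsilon>: "\<tau> + \<epsilon> \<in> cdomain \<gamma>'" using \<tau>(2) mem_cdomain_shift by blast
    have "arclength (shift \<epsilon> \<gamma>') \<tau> = \<sigma> * (lac_length \<beta> (\<theta> * \<tau> + \<theta> * \<epsilon>) - lac_length \<beta> (\<theta> * \<epsilon>))"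
      using \<epsilon> unfolding shift_invariants(1)[OF \<gamma>' \<epsilon> \<tau>\<epsilon>] S[OF \<epsilon>] S[OF \<tau>\<epsilon>]
      by (simp add: base tb algebra_simps)
    moreover have "\<mu> powr \<epsilon> = exp (\<beta> * (\<theta> * \<epsilon>))"
      by (simp add: \<mu>_def powr_def mult_ac)
    moreover have "curvature (shift \<epsilon> \<gamma>') \<tau> * \<nu> powr \<epsilon> = curvature \<gamma>' \<tau>"
      unfolding shift_invariants(2)[OF \<gamma>' \<epsilon> \<tau>\<epsilon>] K[OF \<tau>\<epsilon>] K[OF \<tau>(1)]
      by (simp add: \<nu>_def powr_def mult.assoc exp_add[symmetric] algebra_simps)
    moreover have "\<nu> powr \<epsilon> > 0" by (simp add: \<nu>_def)
    ultimately show ?thesis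
      unfolding curvature_radius_def
      by (simp add: ereal_divide_eq_mult_iff lac_length_add S[OF \<tau>(1)])
  qed
  moreover have "\<mu> > 0" "\<nu> > 0" by (simp_all add: \<mu>_def \<nu>_def)
  ultimately show ?thesis
    unfolding MSA_def using \<gamma>' rep ex by blast
qed

text \<open>Differentiating the affinity of the arc length in the shift at \<open>0\<close> gives the linear equation
  \<open>S' = g \<eta> + m * S\<close>. The last point of the interval, if it exists, admits no shift and is
  reached by continuity.\<close>

lemma shift_affine_imp_lac_length:
  fixes S g :: "real \<Rightarrow> real"
  assumes J: "is_interval J" and \<eta>: "\<eta> \<in> J" "S \<eta> = 0"
    and \<delta>: "\<delta> > 0" "\<eta> + \<delta> \<in> J"
    and S: "\<And>t. t \<in> J \<Longrightarrow> (S has_real_derivative g t) (at t within J)"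
    and shift: "\<And>t \<epsilon>. \<epsilon> > 0 \<Longrightarrow> \<eta> + \<epsilon> \<in> J \<Longrightarrow> t \<in> J \<Longrightarrow> t + \<epsilon> \<in> J \<Longrightarrow>
      S (t + \<epsilon>) - S (\<eta> + \<epsilon>) = exp (m * \<epsilon>) * S t"
    and t: "t \<in> J"
  shows "S t = g \<eta> * lac_length m (t - \<eta>)"
proof -
  have ode: "g t = g \<eta> + m * S t" if t: "t \<in> J" and x: "x \<in> J" "t < x" for t x
  proof -
    \<comment> \<open>Shifts up to \<open>e\<close> keep both the base point and \<open>t\<close> in
      \<open>J\<close>; the point \<open>x\<close> beyond \<open>t\<close> makes \<open>e\<close>
      positive.\<close>
    define e where "e = min \<delta> (x - t)"
    have e: "e > 0" using \<delta> x by (simp add: e_def)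
    have mem: "\<eta> + \<epsilon> \<in> J" "t + \<epsilon> \<in> J" if "\<epsilon> \<in> {0..e}" for \<epsilon>
      using mem_is_interval_1_I[OF J \<eta>(1) \<delta>(2), of "\<eta> + \<epsilon>"] mem_is_interval_1_I[OF J t x(1), of "t + \<epsilon>"] that
      by (auto simp: e_def)
    have trans: "((\<lambda>\<epsilon>. S (c + \<epsilon>)) has_real_derivative g c) (at 0 within {0..e})"
      if "c \<in> J" "\<And>\<epsilon>. \<epsilon> \<in> {0..e} \<Longrightarrow> c + \<epsilon> \<in> J" for c
    proof -
      have "(S has_vector_derivative g c) (at (c + 0) within (\<lambda>\<epsilon>. c + \<epsilon>) ` {0..e})"
      proof (rule has_vector_derivative_within_subset)
        show "(S has_vector_derivative g c) (at (c + 0) within J)"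
          using S[OF that(1)] by (simp add: has_real_derivative_iff_has_vector_derivative)
        show "(\<lambda>\<epsilon>. c + \<epsilon>) ` {0..e} \<subseteq> J" using that(2) by blast
      qed
      then have "((S \<circ> (\<lambda>\<epsilon>. c + \<epsilon>)) has_vector_derivative 1 *\<^sub>R g c) (at 0 within {0..e})"
        by (intro vector_diff_chain_within) (auto intro!: derivative_eq_intros)
      then show ?thesis by (simp add: o_def has_real_derivative_iff_has_vector_derivative)
    qed
    have "((\<lambda>\<epsilon>. S (t + \<epsilon>) - S (\<eta> + \<epsilon>) - exp (m * \<epsilon>) * S t) has_real_derivative
        g t - g \<eta> - m * S t) (at 0 within {0..e})"
      using trans[OF t mem(2)] trans[OF \<eta>(1) mem(1)]
      by (auto intro!: derivative_eq_intros)
    \<comment> \<open>The hypothesis concerns positive shifts only; at \<epsilon> = 0 the relation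
      holds because \<open>S \<eta> = 0\<close>.\<close>
    moreover have "S (t + \<epsilon>) - S (\<eta> + \<epsilon>) - exp (m * \<epsilon>) * S t = 0" if "\<epsilon> \<in> {0..e}" for \<epsilon>
      using shift[OF _ mem(1) t mem(2), OF _ that that] that \<eta>(2) by (cases "\<epsilon> = 0") auto
    ultimately have "((\<lambda>\<epsilon>. 0) has_vector_derivative g t - g \<eta> - m * S t) (at 0 within {0..e})"
      using e unfolding has_real_derivative_iff_has_vector_derivative
      by (intro has_vector_derivative_transform[of 0 "{0..e}" "\<lambda>_. 0"
            "\<lambda>\<epsilon>. S (t + \<epsilon>) - S (\<eta> + \<epsilon>) - exp (m * \<epsilon>) * S t"]) auto
    then have "g t - g \<eta> - m * S t = 0"
      using vector_derivative_unique_within_closed_interval[of 0 e 0 "\<lambda>_. 0"] e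
        has_vector_derivative_const by (metis atLeastAtMost_iff box_real(2) less_eq_real_def)
    then show ?thesis by simp
  qed
  \<comment> \<open>The deviation from the expected solution times an integrating factor; its
    derivative is the defect in the differential equation times
    \<open>exp (- m * t)\<close>.\<close>
  define f where "f = (\<lambda>t. (S t - g \<eta> * lac_length m (t - \<eta>)) * exp (- m * t))"
  have df: "(f has_real_derivative (g t - g \<eta> - m * S t) * exp (- m * t)) (at t within J)"
    if t: "t \<in> J" for t
  proof -
    have "((\<lambda>t. lac_length m (t - \<eta>)) has_real_derivative exp (m * (t - \<eta>)) * (1 - 0)) (at t within J)"
      by (rule DERIV_chain'[OF DERIV_diff[OF DERIV_ident DERIV_const] lac_length_has_derivative])
    then have "((\<lambda>t. lac_length m (t - \<eta>)) has_real_derivative 1 + m * lac_length m (t - \<eta>)) (at t within J)"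
      by (simp add: one_plus_lac_length)
    then show ?thesis
      unfolding f_def by (auto intro!: derivative_eq_intros S[OF t] simp: algebra_simps)
  qed
  have "f t = 0"
  \<comment> \<open>The rule tolerates a finite exceptional set, here the last point of
    \<open>J\<close> if there is one.\<close>
  proof (rule has_derivative_zero_unique_strong_convex[of J "{t\<in>J. \<forall>x\<in>J. x \<le> t}" f \<eta> 0 t])
    have "is_singleton {t\<in>J. \<forall>x\<in>J. x \<le> t} \<or> {t\<in>J. \<forall>x\<in>J. x \<le> t} = {}"
      by (intro disjCI is_singletonI') (auto intro: order_antisym)
    then show "finite {t\<in>J. \<forall>x\<in>J. x \<le> t}"
      by (auto simp only: is_singleton_def finite.intros)
    show "convex J" using J by (simp add: is_interval_convex_1)
    show "continuous_on J f" by (rule DERIV_continuous_on[OF df])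
    show "f \<eta> = 0" using \<eta> by (simp add: f_def lac_length_def)
    show "(f has_derivative (\<lambda>h. 0)) (at x within J)" if x: "x \<in> J - {t\<in>J. \<forall>x\<in>J. x \<le> t}" for x
    proof -
      obtain z where "z \<in> J" "x < z" using x by force
      then have "g x - g \<eta> - m * S x = 0" using ode x by auto
      moreover have "(*) (0::real) = (\<lambda>h. 0)" by (simp add: fun_eq_iff)
      ultimately show ?thesis using df[of x] x by (simp add: has_field_derivative_def)
    qed
  qed (use \<eta> t in auto)
  then show ?thesis by (simp add: f_def)
qed

text \<open>A shift must keep the base point in \<open>J\<close>, and those below \<delta> do. Hence
  \<open>K t * exp (n * t)\<close> agrees at points closer than \<delta>, so it is locally constant,
  and \<open>J\<close> is connected.\<close>

lemma shift_scaling_imp_exp: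
  fixes K :: "real \<Rightarrow> real"
  assumes J: "is_interval J" and \<eta>: "\<eta> \<in> J" and \<delta>: "\<delta> > 0" "\<eta> + \<delta> \<in> J"
    and shift: "\<And>t \<epsilon>. \<epsilon> > 0 \<Longrightarrow> \<eta> + \<epsilon> \<in> J \<Longrightarrow> t \<in> J \<Longrightarrow> t + \<epsilon> \<in> J \<Longrightarrow> K (t + \<epsilon>) * exp (n * \<epsilon>) = K t"
    and t: "t \<in> J"
  shows "K t = K \<eta> * exp (- n * (t - \<eta>))"
proof -
  define f where "f = (\<lambda>t. K t * exp (n * t))"
  have step: "f x = f y" if "x \<in> J" "y \<in> J" "x < y" "y < x + \<delta>" for x y
  proof -
    have "\<eta> + (y - x) \<in> J"
      using mem_is_interval_1_I[OF J \<eta> \<delta>(2)] that by simp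
    then have "K y * exp (n * (y - x)) = K x" using shift[of "y - x" x] that by simp
    then have "f x = K y * (exp (n * (y - x)) * exp (n * x))" by (simp add: f_def)
    then show ?thesis by (simp add: f_def exp_add[symmetric] algebra_simps)
  qed
  have "f t = f \<eta>"
  proof (rule connected_local_const[of J t \<eta> f])
    show "connected J" using J by (simp add: is_interval_connected_1)
    show "\<forall>a\<in>J. eventually (\<lambda>b. f a = f b) (at a within J)"
    proof
      fix a assume a: "a \<in> J"
      have "f a = f b" if "b \<in> J" "dist b a < \<delta>" for b
      proof (cases a b rule: linorder_cases)
        case less
        then show ?thesis using that a by (intro step) (auto simp: dist_real_def)
      next
        case greater
        then show ?thesis using that a by (intro step[symmetric]) (auto simp: dist_real_def)
      qed simp
      then show "eventually (\<lambda>b. f a = f b) (at a within J)"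
        unfolding eventually_at using \<delta>(1) by blast
    qed
  qed (use \<eta> t in auto)
  have "K t = f t * exp (- (n * t))" by (simp add: f_def mult.assoc exp_add[symmetric])
  also have "\<dots> = f \<eta> * exp (- (n * t))" using \<open>f t = f \<eta>\<close> by simp
  also have "\<dots> = K \<eta> * exp (- n * (t - \<eta>))" by (simp add: f_def mult.assoc exp_add[symmetric] algebra_simps)
  finally show ?thesis .
qed

text \<open>Both relations are solved in the parameter of \<open>\<gamma>'\<close>, which is then
  eliminated. The orientation sign \<sigma> and the base speed c convert ln \<mu> and ln \<nu> into
  the constants \<beta> and d of the normal form.\<close>

lemma MSA_imp_exponential_curvature:
  assumes \<gamma>: "is_curve \<gamma>" and "MSA \<gamma>"
  shows "exponential_curvature \<gamma>"
proof -
  obtain \<mu> \<nu> \<gamma>' t where \<mu>: "\<mu> > 0" and \<nu>: "\<nu> > 0" and \<gamma>': "is_curve \<gamma>'"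
    and rep: "reparametrization \<gamma> \<gamma>' t" and ex: "\<exists>\<epsilon>>0. is_curve (shift \<epsilon> \<gamma>')"
    and aff: "\<And>\<epsilon> t. \<epsilon> > 0 \<Longrightarrow> is_curve (shift \<epsilon> \<gamma>') \<Longrightarrow> t \<in> cdomain \<gamma>' \<inter> cdomain (shift \<epsilon> \<gamma>') \<Longrightarrow>
      arclength (shift \<epsilon> \<gamma>') t = \<mu> powr \<epsilon> * arclength \<gamma>' t \<and>
      curvature_radius (shift \<epsilon> \<gamma>') t = ereal (\<nu> powr \<epsilon>) * curvature_radius \<gamma>' t"
    using assms(2) unfolding MSA_def by blast
  define J where "J = cdomain \<gamma>'"
  define \<eta> where "\<eta> = cbase \<gamma>'"
  define c where "c = norm (velocity \<gamma>' \<eta>)"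
  have J: "is_interval J" "\<eta> \<in> J" using \<gamma>' by (auto simp: J_def \<eta>_def is_curve_def)
  have c: "c > 0" using velocity_nonzero[OF \<gamma>'] J(2) by (simp add: c_def J_def)
  obtain \<delta> where \<delta>: "\<delta> > 0" "\<eta> + \<delta> \<in> J"
    using ex is_curve_shift_iff[OF \<gamma>'] by (auto simp: J_def \<eta>_def)
  have shift: "arclength \<gamma>' (t + \<epsilon>) - arclength \<gamma>' (\<eta> + \<epsilon>) = exp (ln \<mu> * \<epsilon>) * arclength \<gamma>' t"
    "curvature \<gamma>' (t + \<epsilon>) * exp (ln \<nu> * \<epsilon>) = curvature \<gamma>' t"
    if \<epsilon>: "\<epsilon> > 0" "\<eta> + \<epsilon> \<in> J" and t: "t \<in> J" "t + \<epsilon> \<in> J" for t \<epsilon>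
  proof -
    have base: "cbase \<gamma>' + \<epsilon> \<in> cdomain \<gamma>'" and t\<epsilon>: "t + \<epsilon> \<in> cdomain \<gamma>'"
      using \<epsilon>(2) t(2) by (simp_all add: \<eta>_def J_def)
    then have "is_curve (shift \<epsilon> \<gamma>')" using is_curve_shift_iff[OF \<gamma>'] by blast
    moreover have "t \<in> cdomain \<gamma>' \<inter> cdomain (shift \<epsilon> \<gamma>')"
      using t mem_cdomain_shift by (simp add: J_def)
    ultimately have *: "arclength (shift \<epsilon> \<gamma>') t = \<mu> powr \<epsilon> * arclength \<gamma>' t"
      "curvature_radius (shift \<epsilon> \<gamma>') t = ereal (\<nu> powr \<epsilon>) * curvature_radius \<gamma>' t"
      using aff \<epsilon>(1) by blast+
    have powr: "\<mu> powr \<epsilon> = exp (ln \<mu> * \<epsilon>)" "\<nu> powr \<epsilon> = exp (ln \<nu> * \<epsilon>)"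
      using \<mu> \<nu> by (simp_all add: powr_def mult.commute)
    show "arclength \<gamma>' (t + \<epsilon>) - arclength \<gamma>' (\<eta> + \<epsilon>) = exp (ln \<mu> * \<epsilon>) * arclength \<gamma>' t"
      using *(1) shift_invariants(1)[OF \<gamma>' base t\<epsilon>] by (simp add: \<eta>_def powr)
    show "curvature \<gamma>' (t + \<epsilon>) * exp (ln \<nu> * \<epsilon>) = curvature \<gamma>' t"
      using *(2) unfolding curvature_radius_def powr
      by (simp add: ereal_divide_eq_mult_iff shift_invariants(2)[OF \<gamma>' base t\<epsilon>])
  qed
  have S: "arclength \<gamma>' \<tau> = c * lac_length (ln \<mu>) (\<tau> - \<eta>)" if "\<tau> \<in> J" for \<tau>
    unfolding c_def using has_real_derivative_arclength[OF \<gamma>']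
    by (intro shift_affine_imp_lac_length[OF J _ \<delta> _ shift(1) that]) (auto simp: \<eta>_def J_def)
  have K: "curvature \<gamma>' \<tau> = curvature \<gamma>' \<eta> * exp (- ln \<nu> * (\<tau> - \<eta>))" if "\<tau> \<in> J" for \<tau>
    by (rule shift_scaling_imp_exp[OF J \<delta> shift(2) that])
  obtain \<sigma> :: real where \<sigma>: "\<sigma> \<in> {1, -1}"
    and s: "\<And>u. u \<in> cdomain \<gamma> \<Longrightarrow> arclength \<gamma> u = \<sigma> * arclength \<gamma>' (t u)"
    and \<kappa>: "\<And>u. u \<in> cdomain \<gamma> \<Longrightarrow> curvature \<gamma> u = \<sigma> * curvature \<gamma>' (t u)"
    using reparametrization_invariants[OF \<gamma> \<gamma>' rep] by metis
  have \<sigma>\<sigma>: "\<sigma> * \<sigma> = 1" using \<sigma> by auto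
  \<comment> \<open>The arc length S of \<open>\<gamma>'\<close> satisfies S' = c + ln \<mu> * S,
    and s = \<sigma> S; with this \<beta> the factor 1 + \<beta> s is the relative speed S' / c, a
    pure exponential in the parameter.\<close>
  define \<beta> where "\<beta> = ln \<mu> * \<sigma> / c"
  have "1 + \<beta> * arclength \<gamma> u > 0 \<and>
      curvature \<gamma> u = \<sigma> * curvature \<gamma>' \<eta> * exp (- (ln \<nu> * \<sigma> / c) * lac_time \<beta> (arclength \<gamma> u))"
    if u: "u \<in> cdomain \<gamma>" for u
  proof -
    have tu: "t u \<in> J" using rep u by (auto simp: reparametrization_def homeomorphism_def J_def)
    define \<tau> where "\<tau> = t u - \<eta>"
    have su: "arclength \<gamma> u = \<sigma> * c * lac_length (ln \<mu>) \<tau>"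
      using s[OF u] S[OF tu] by (simp add: \<tau>_def)
    have "\<beta> * arclength \<gamma> u = \<sigma> * \<sigma> * (ln \<mu> * lac_length (ln \<mu>) \<tau>)"
      using c by (simp add: \<beta>_def su)
    then have one: "1 + \<beta> * arclength \<gamma> u = exp (ln \<mu> * \<tau>)"
      by (simp only: \<sigma>\<sigma> mult_1 one_plus_lac_length)
    \<comment> \<open>Recovers the parameter from s. The factors \<sigma> and c are those in d = ln
      \<nu> * \<sigma> / c, so the exponent becomes ln \<nu> * \<tau>.\<close>
    have "\<sigma> * lac_time \<beta> (arclength \<gamma> u) = c * \<tau>"
    proof (cases "ln \<mu> = 0")
      case True
      then show ?thesis
        using \<sigma>\<sigma> by (simp add: lac_time_def \<beta>_def su lac_length_def mult.assoc[symmetric])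
    next
      case False
      then have "\<beta> \<noteq> 0" using c \<sigma>\<sigma> by (auto simp: \<beta>_def)
      then have "lac_time \<beta> (arclength \<gamma> u) = ln \<mu> * \<tau> / \<beta>"
        by (simp add: lac_time_def one)
      then show ?thesis using c False \<sigma> by (auto simp: \<beta>_def field_simps)
    qed
    then have "(ln \<nu> * \<sigma> / c) * lac_time \<beta> (arclength \<gamma> u) = ln \<nu> * \<tau>"
      using c by (simp add: field_simps)
    then show ?thesis
      using one \<kappa>[OF u] K[OF tu] by (simp add: \<tau>_def)
  qed
  then show ?thesis unfolding exponential_curvature_def by blast
qed

theorem theorem1p1:
  fixes \<gamma> :: pcurve
  assumes "is_curve \<gamma>"
  shows "MSA \<gamma> \<longleftrightarrow> is_circle \<gamma> \<or> is_line \<gamma> \<or> is_LAC \<gamma>"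
  using exponential_curvature_iff[OF assms] exponential_curvature_imp_MSA[OF assms]
    MSA_imp_exponential_curvature[OF assms] by blast

end
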